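(* Let $a,b,c,\gamma>0$ be constants, let $x_0\in\mathbb{R}$, and let $X(\cdot)$ be the diffusion process started from $x_0$ corresponding to the operator $$L=\frac12a\frac{d^2}{dx^2}+b(t,X(\cdot))\frac d{dx},\qquad b(t,X(\cdot))=\begin{cases} b, & \text{if } X(t)>X^*(t)-\gamma,\\ c, & \text{if } X(t)\le X^*(t)-\gamma,\end{cases}$$ where $X^*(t)=\max_{0\le s\le t}X(s)$. Then $$\lim_{t\to\infty}\frac{X(t)}t=\left(\frac{c\big(e^{\frac{2b\gamma}a}-1\big)}{c\big(e^{\frac{2b\gamma}a}-1\big)+(b-c)\big(1-e^{-\frac{2b\gamma}a}\big)}\right)b\quad\text{almost surely.}$$
   Context: The diffusion corresponding to $L$ started from $x_0$ is the solution of the stochastic differential equation $$X(t)=x_0+\sqrt a\,W(t)+\int_0^t b(s,X(\cdot))\,ds,$$ where $W$ is a standard one-dimensional Brownian motion and $b(s,X(\cdot))$ is the path-dependent (non-anticipating) drift defined in the claim. Here $b$ without arguments denotes the positive constant. *)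

theory Defs
  imports "HOL-Probability.Probability"
begin

text \<open>
  Processes and filtrations are indexed by \<^typ>\<open>real\<close>, but only times \<open>t \<ge> 0\<close> carry content:
  a filtration \<open>(F t)\<close> with \<open>t \<ge> 0\<close> is extended to negative times by \<open>F t = F 0\<close>, say, and no
  condition is imposed on a process at negative times.
\<close>

definition filtered_prob_space :: "'a measure \<Rightarrow> (real \<Rightarrow> 'a measure) \<Rightarrow> bool" where
  "filtered_prob_space M F \<longleftrightarrow>
     prob_space M \<and> filtration (space M) F \<and> (\<forall>t. subalgebra M (F t))"

definition adapted_process :: "(real \<Rightarrow> 'a measure) \<Rightarrow> (real \<Rightarrow> 'a \<Rightarrow> real) \<Rightarrow> bool" where
  "adapted_process F X \<longleftrightarrow> (\<forall>t\<ge>0. X t \<in> borel_measurable (F t))"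

definition brownian_motion ::
  "'a measure \<Rightarrow> (real \<Rightarrow> 'a measure) \<Rightarrow> (real \<Rightarrow> 'a \<Rightarrow> real) \<Rightarrow> bool" where
  "brownian_motion M F W \<longleftrightarrow>
     adapted_process F W \<and>
     (AE \<omega> in M. W 0 \<omega> = 0) \<and>
     (AE \<omega> in M. continuous_on {0..} (\<lambda>t. W t \<omega>)) \<and>
     (\<forall>s t. 0 \<le> s \<and> s < t \<longrightarrow>
        distributed M lborel (\<lambda>\<omega>. W t \<omega> - W s \<omega>) (normal_density 0 (sqrt (t - s))) \<and>
        prob_space.indep_set M (sets (F s))
          (sets (vimage_algebra (space M) (\<lambda>\<omega>. W t \<omega> - W s \<omega>) borel)))"

text \<open>
  A (weak) solution \<open>X\<close> of \<open>X(t) = x0 + sqrt a * W(t) + \<integral>\<^sub>0\<^sup>t \<beta>(s, X(\<cdot>)) ds\<close> driven by \<open>W\<close>. The drift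
  \<open>\<beta>\<close> receives the whole path, so that it may depend on the past. Strong solutions are the case
  in which \<open>F\<close> is the completed filtration generated by \<open>W\<close>.
\<close>

definition diffusion_solution ::
  "'a measure \<Rightarrow> (real \<Rightarrow> 'a measure) \<Rightarrow> (real \<Rightarrow> 'a \<Rightarrow> real) \<Rightarrow>
   real \<Rightarrow> (real \<Rightarrow> (real \<Rightarrow> real) \<Rightarrow> real) \<Rightarrow> real \<Rightarrow> (real \<Rightarrow> 'a \<Rightarrow> real) \<Rightarrow> bool" where
  "diffusion_solution M F W a \<beta> x0 X \<longleftrightarrow>
     adapted_process F X \<and>
     (AE \<omega> in M. continuous_on {0..} (\<lambda>t. X t \<omega>)) \<and>
     (AE \<omega> in M. \<forall>t\<ge>0.
        set_integrable lborel {0..t} (\<lambda>s. \<beta> s (\<lambda>u. X u \<omega>)) \<and>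
        X t \<omega> = x0 + sqrt a * W t \<omega> + (LINT s:{0..t}|lborel. \<beta> s (\<lambda>u. X u \<omega>)))"

text \<open>For a continuous path the supremum is attained, so this is the maximum over \<open>[0, t]\<close>.\<close>

definition running_max :: "(real \<Rightarrow> real) \<Rightarrow> real \<Rightarrow> real" where
  "running_max x t = (SUP s\<in>{0..t}. x s)"

definition drawdown_drift ::
  "real \<Rightarrow> real \<Rightarrow> real \<Rightarrow> real \<Rightarrow> (real \<Rightarrow> real) \<Rightarrow> real" where
  "drawdown_drift b c \<gamma> t x = (if x t > running_max x t - \<gamma> then b else c)"

end

theory Submission
  imports Defs
begin

text \<open>
  Write \<open>Y = X\<^sup>* - X\<close> for the drawdown, \<open>\<beta>(y) = b\<close> for \<open>y < \<gamma>\<close> and \<open>\<beta>(y) = c\<close> otherwise, and \<open>v\<close> for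
  the claimed speed. If \<open>g(0) = 0\<close>, \<open>p = g'\<close>, \<open>p(0) = 1\<close> and \<open>\<beta> p - (a/2) p' = v\<close>, then by Ito's formula
  \<open>X\<^sup>*(t) - g(Y(t)) - v t\<close> is a constant plus the martingale with integrand \<open>sqrt a p(Y)\<close>: the condition
  \<open>p(0) = 1\<close> cancels the growth of \<open>X\<^sup>*\<close>, which happens only where \<open>Y = 0\<close>. The bounded solution is
  \<open>p(y) = v/b + (1 - v/b) exp (2 b min(y, \<gamma>) / a)\<close>, and boundedness beyond \<open>\<gamma>\<close> is what determines \<open>v\<close>.

  Stochastic integrals are avoided. On a dyadic grid of \<open>[0, T]\<close>, with the maximum over grid points in
  place of \<open>X\<^sup>*\<close>, a Taylor expansion gives this identity up to errors that vanish pathwise as the mesh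
  tends to zero, and the discrete martingale transforms have second moment at most \<open>P\<^sup>2 T\<close>, where \<open>P\<close>
  bounds \<open>p\<close>. Fatou's lemma transfers this bound to the limit, and summation along \<open>T = (m + 1)\<^sup>2\<close> gives a law
  of large numbers. The discontinuity of \<open>p'\<close> at \<open>\<gamma>\<close> is smoothed at the cost of an arbitrarily small
  error, with a separate smoothing for the upper and the lower bound of the speed. Finally
  \<open>Y(t) / t \<rightarrow> 0\<close>, because the drift is nonnegative and \<open>W(t) / t \<rightarrow> 0\<close>.
\<close>

subsection \<open>Second moments of discrete martingale transforms\<close>

text \<open>Monotone convergence makes the mean of the whole series finite, so the series is finite
  almost surely and its terms vanish. This replaces Chebyshev's inequality with Borel-Cantelli
  wherever second moments are summable.\<close>

lemma AE_tendsto_zero_of_summable: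
  fixes Z :: "nat \<Rightarrow> 'a \<Rightarrow> ennreal"
  assumes [measurable]: "\<And>k. Z k \<in> borel_measurable M"
    and bound: "\<And>k. (\<integral>\<^sup>+x. Z k x \<partial>M) \<le> ennreal (u k)"
    and u: "summable u" "\<And>k. 0 \<le> u k"
  shows "AE x in M. (\<lambda>k. Z k x) \<longlonglongrightarrow> 0"
proof -
  have "(\<integral>\<^sup>+x. (\<Sum>k. Z k x) \<partial>M) = (\<Sum>k. \<integral>\<^sup>+x. Z k x \<partial>M)"
    by (rule nn_integral_suminf) measurable
  also have "\<dots> \<le> (\<Sum>k. ennreal (u k))"
    by (intro suminf_le bound) auto
  also have "\<dots> = ennreal (\<Sum>k. u k)"
    by (intro suminf_ennreal2 u)
  also have "\<dots> < \<infinity>" by simp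
  finally have "(\<integral>\<^sup>+x. (\<Sum>k. Z k x) \<partial>M) \<noteq> \<infinity>" by simp
  then have "AE x in M. (\<Sum>k. Z k x) \<noteq> \<infinity>"
    by (intro nn_integral_PInf_AE) measurable
  then show ?thesis
  proof eventually_elim
    case (elim x)
    have fin: "Z k x \<noteq> \<infinity>" for k
    proof
      assume "Z k x = \<infinity>"
      then have "(\<Sum>k. Z k x) = \<infinity>"
        using sum_le_suminf[of "\<lambda>k. Z k x" "{k}"] by (simp add: top_unique)
      with elim show False by simp
    qed
    then have eq: "Z k x = ennreal (enn2real (Z k x))" for k
      by (simp add: less_top)
    have "summable (\<lambda>k. enn2real (Z k x))"
    proof (rule summable_suminf_not_top)
      show "(\<Sum>k. ennreal (enn2real (Z k x))) \<noteq> top"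
        using elim by (simp flip: eq)
    qed auto
    then have "(\<lambda>k. enn2real (Z k x)) \<longlonglongrightarrow> 0"
      by (rule summable_LIMSEQ_zero)
    then have "(\<lambda>k. ennreal (enn2real (Z k x))) \<longlonglongrightarrow> ennreal 0"
      by (intro tendsto_ennrealI)
    then show ?case by (simp flip: eq)
  qed
qed

locale filtered_brownian_motion =
  fixes M :: "'a measure" and F :: "real \<Rightarrow> 'a measure" and W :: "real \<Rightarrow> 'a \<Rightarrow> real"
  assumes filtered: "filtered_prob_space M F"
    and brownian: "brownian_motion M F W"

sublocale filtered_brownian_motion \<subseteq> prob_space M
  using filtered by (simp add: filtered_prob_space_def)

context filtered_brownian_motion
begin

lemma space_F [simp]: "space (F t) = space M"
  using filtered by (auto simp: filtered_prob_space_def subalgebra_def)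

lemma sets_F_le: "sets (F t) \<subseteq> sets M"
  using filtered by (auto simp: filtered_prob_space_def subalgebra_def)

lemma sets_F_mono: "s \<le> t \<Longrightarrow> sets (F s) \<subseteq> sets (F t)"
  using filtered by (auto simp: filtered_prob_space_def filtration_def)

lemma measurable_F_mono: "f \<in> borel_measurable (F s) \<Longrightarrow> s \<le> t \<Longrightarrow> f \<in> borel_measurable (F t)"
  using sets_F_mono[of s t] unfolding measurable_def by auto

lemma measurable_F_M: "f \<in> borel_measurable (F s) \<Longrightarrow> f \<in> borel_measurable M"
  using sets_F_le[of s] unfolding measurable_def by auto

lemma W_measurable_F: "0 \<le> s \<Longrightarrow> s \<le> t \<Longrightarrow> W s \<in> borel_measurable (F t)"
  using brownian measurable_F_mono by (auto simp: brownian_motion_def adapted_process_def)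

lemma increment_measurable_F:
  "0 \<le> s \<Longrightarrow> s \<le> u \<Longrightarrow> 0 \<le> t \<Longrightarrow> t \<le> u \<Longrightarrow> (\<lambda>\<omega>. W t \<omega> - W s \<omega>) \<in> borel_measurable (F u)"
  by (intro borel_measurable_diff W_measurable_F)

lemma W_measurable: "0 \<le> s \<Longrightarrow> W s \<in> borel_measurable M"
  using measurable_F_M W_measurable_F by blast

text \<open>Independence is given for \<sigma>-algebras. Both variables generate
  sub-\<sigma>-algebras of the two given ones, and independence passes to subfamilies.\<close>

lemma increment_indep:
  assumes H: "H \<in> borel_measurable (F s)" and st: "0 \<le> s" "s < t"
    and \<phi>: "\<phi> \<in> borel_measurable borel"
  shows "indep_var borel H borel (\<lambda>\<omega>. \<phi> (W t \<omega> - W s \<omega>) :: real)"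
proof -
  let ?D = "\<lambda>\<omega>. W t \<omega> - W s \<omega>"
  have D: "?D \<in> borel_measurable M"
    using st W_measurable by (intro borel_measurable_diff) auto
  have ind: "indep_set (sets (F s)) (sets (vimage_algebra (space M) ?D borel))"
    using brownian st by (auto simp: brownian_motion_def)
  have 1: "sigma_sets (space M) {H -` A \<inter> space M |A. A \<in> sets borel} \<subseteq> sets (F s)"
    using H by (intro sets.sigma_sets_subset[of _ "F s", simplified]) (auto simp: measurable_def)
  have "?D \<in> measurable (vimage_algebra (space M) ?D borel) borel"
    by (rule measurable_vimage_algebra1) auto
  then have "(\<lambda>\<omega>. \<phi> (?D \<omega>)) \<in> measurable (vimage_algebra (space M) ?D borel) borel"
    using \<phi> by (rule measurable_compose)
  then have 2: "sigma_sets (space M) {(\<lambda>\<omega>. \<phi> (?D \<omega>)) -` A \<inter> space M |A. A \<in> sets borel}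
      \<subseteq> sets (vimage_algebra (space M) ?D borel)"
    by (intro sets.sigma_sets_subset[of _ "vimage_algebra (space M) ?D borel", simplified])
      (auto simp: measurable_def)
  have "indep_set (sigma_sets (space M) {H -` A \<inter> space M |A. A \<in> sets borel})
     (sigma_sets (space M) {(\<lambda>\<omega>. \<phi> (?D \<omega>)) -` A \<inter> space M |A. A \<in> sets borel})"
    using ind unfolding indep_set_def
    by (rule indep_sets_mono) (use 1 2 in \<open>auto split: bool.splits\<close>)
  moreover have "(\<lambda>\<omega>. \<phi> (?D \<omega>)) \<in> borel_measurable M"
    using D \<phi> by (rule measurable_compose)
  ultimately show ?thesis
    unfolding indep_var_eq using measurable_F_M[OF H] by auto
qed

text \<open>Gaussian moments. The last one, from the fourth moment
  \<open>3 * (t - s)\<^sup>2\<close>, is what makes the quadratic variation along a grid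
  concentrate.\<close>

lemma increment_moments:
  assumes st: "0 \<le> s" "s < t"
  shows "integrable M (\<lambda>\<omega>. (W t \<omega> - W s \<omega>) ^ n)"
    and "expectation (\<lambda>\<omega>. W t \<omega> - W s \<omega>) = 0"
    and "expectation (\<lambda>\<omega>. (W t \<omega> - W s \<omega>)\<^sup>2) = t - s"
    and "expectation (\<lambda>\<omega>. ((W t \<omega> - W s \<omega>)\<^sup>2 - (t - s))\<^sup>2) = 2 * (t - s)\<^sup>2"
proof -
  let ?D = "\<lambda>\<omega>. W t \<omega> - W s \<omega>" and ?d = "normal_density 0 (sqrt (t - s))"
  have D: "distributed M lborel ?D ?d"
    using brownian st by (auto simp: brownian_motion_def)
  have pos: "0 < sqrt (t - s)" using st by simp
  show int: "integrable M (\<lambda>\<omega>. ?D \<omega> ^ n)" for n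
    using distributed_integrable[OF D, of "\<lambda>x. x ^ n"] integrable_normal_moment[OF pos, of 0 n] by simp
  have E: "expectation (\<lambda>\<omega>. ?D \<omega> ^ n) = (\<integral>x. ?d x * x ^ n \<partial>lborel)" for n
    using distributed_integral[OF D, of "\<lambda>x. x ^ n"] by simp
  show "expectation ?D = 0"
    using E[of 1] integral_normal_moment_odd[OF pos, of 0 0] by simp
  show E2: "expectation (\<lambda>\<omega>. (?D \<omega>)\<^sup>2) = t - s"
    using E[of 2] integral_normal_moment_even[OF pos, of 0 1] st by simp
  have E4: "expectation (\<lambda>\<omega>. ?D \<omega> ^ 4) = 3 * (t - s)\<^sup>2"
    using E[of 4] integral_normal_moment_even[OF pos, of 0 2] st
    by (simp add: fact_numeral power_divide)
  have sq: "(x\<^sup>2 - d)\<^sup>2 = x ^ 4 - 2 * d * x\<^sup>2 + d\<^sup>2" for x d :: real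
    by (simp add: power2_eq_square power4_eq_xxxx algebra_simps)
  have "expectation (\<lambda>\<omega>. ((?D \<omega>)\<^sup>2 - (t - s))\<^sup>2) =
      expectation (\<lambda>\<omega>. ?D \<omega> ^ 4 - 2 * (t - s) * (?D \<omega>)\<^sup>2 + (t - s)\<^sup>2)"
    by (simp only: sq)
  also have "\<dots> = 2 * (t - s)\<^sup>2"
    using int[of 4] int[of 2] by (simp add: E2 E4 prob_space) (simp add: power2_eq_square algebra_simps)
  finally show "expectation (\<lambda>\<omega>. ((?D \<omega>)\<^sup>2 - (t - s))\<^sup>2) = 2 * (t - s)\<^sup>2" .
qed

lemma increment_product:
  assumes H: "H \<in> borel_measurable (F s)" "integrable M H" and st: "0 \<le> s" "s < t"
    and \<phi>: "\<phi> \<in> borel_measurable borel" "integrable M (\<lambda>\<omega>. \<phi> (W t \<omega> - W s \<omega>))"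
  shows "integrable M (\<lambda>\<omega>. H \<omega> * \<phi> (W t \<omega> - W s \<omega>) :: real)"
    and "expectation (\<lambda>\<omega>. H \<omega> * \<phi> (W t \<omega> - W s \<omega>)) =
      expectation H * expectation (\<lambda>\<omega>. \<phi> (W t \<omega> - W s \<omega>))"
  using increment_indep[OF H(1) st \<phi>(1)] H(2) \<phi>(2)
  by (auto intro: indep_var_integrable indep_var_lebesgue_integral)

text \<open>Orthogonality of martingale differences: the cross terms have mean zero, and each
  diagonal term is at most \<open>C\<^sup>2 * v\<close>. The function \<open>\<phi>\<close> is later
  the identity, for discrete stochastic integrals, or the centred square, for quadratic
  variation.\<close>

lemma transform_second_moment:
  fixes H :: "nat \<Rightarrow> 'a \<Rightarrow> real" and \<phi> :: "real \<Rightarrow> real"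
  defines "\<xi> \<equiv> \<lambda>\<tau> k \<omega>. \<phi> (W (\<tau> (Suc k)) \<omega> - W (\<tau> k) \<omega>)"
  assumes \<tau>: "0 \<le> \<tau> 0" "\<And>k. \<tau> k < \<tau> (Suc k)"
    and \<phi>: "\<phi> \<in> borel_measurable borel"
    and H: "\<And>k. H k \<in> borel_measurable (F (\<tau> k))" "\<And>k \<omega>. \<bar>H k \<omega>\<bar> \<le> C"
    and \<xi>: "\<And>k. integrable M (\<lambda>\<omega>. (\<xi> \<tau> k \<omega>)\<^sup>2)" "\<And>k. expectation (\<xi> \<tau> k) = 0"
      "\<And>k. expectation (\<lambda>\<omega>. (\<xi> \<tau> k \<omega>)\<^sup>2) = v"
  shows "integrable M (\<lambda>\<omega>. (\<Sum>k<n. H k \<omega> * \<xi> \<tau> k \<omega>)\<^sup>2)"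
    and "expectation (\<lambda>\<omega>. (\<Sum>k<n. H k \<omega> * \<xi> \<tau> k \<omega>)\<^sup>2) \<le> n * C\<^sup>2 * v"
proof -
  let ?S = "\<lambda>n \<omega>. \<Sum>k<n. H k \<omega> * \<xi> \<tau> k \<omega>"
  have \<tau>_nonneg: "0 \<le> \<tau> k" for k
    by (induction k) (use \<tau> in \<open>auto intro: order_trans less_imp_le\<close>)
  have mono: "\<tau> k \<le> \<tau> n" if "k \<le> n" for k n
    using lift_Suc_mono_le[of \<tau>] \<tau>(2) that by (auto intro: less_imp_le)
  have \<xi>_meas: "\<xi> \<tau> k \<in> borel_measurable (F (\<tau> n))" if "k < n" for k n
    unfolding \<xi>_def
    by (rule measurable_compose[OF _ \<phi>], rule increment_measurable_F)
      (use that \<tau>_nonneg mono[of k n] mono[of "Suc k" n] in auto)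
  have S_meas: "?S n \<in> borel_measurable (F (\<tau> n))" for n
    by (intro borel_measurable_sum borel_measurable_times measurable_F_mono[OF H(1)] \<xi>_meas mono) auto
  have \<xi>_int: "integrable M (\<xi> \<tau> k)" for k
    by (rule square_integrable_imp_integrable[OF measurable_F_M[OF \<xi>_meas[of k "Suc k"]] \<xi>(1)]) simp
  note H_M = measurable_F_M[OF H(1)]
  have HH: "(H k \<omega>)\<^sup>2 \<le> C\<^sup>2" for k \<omega>
    using H(2)[of k \<omega>] abs_le_square_iff[of "H k \<omega>" C] by simp
  have "integrable M (\<lambda>\<omega>. (?S n \<omega>)\<^sup>2) \<and> expectation (\<lambda>\<omega>. (?S n \<omega>)\<^sup>2) \<le> n * C\<^sup>2 * v"
  proof (induction n)
    case (Suc n)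
    have S_M: "?S n \<in> borel_measurable M" using S_meas measurable_F_M by blast
    have S_int: "integrable M (?S n)"
      by (rule square_integrable_imp_integrable[OF S_M]) (use Suc in auto)
    have SH_int: "integrable M (\<lambda>\<omega>. ?S n \<omega> * H n \<omega>)"
      by (rule Bochner_Integration.integrable_bound[where f="\<lambda>\<omega>. C * ?S n \<omega>"])
        (use S_int S_M H_M order_trans[OF H(2)[of n] abs_ge_self] in
          \<open>auto simp: abs_mult mult.commute intro!: AE_I2 mult_right_mono\<close>)
    have SH_F: "(\<lambda>\<omega>. ?S n \<omega> * H n \<omega>) \<in> borel_measurable (F (\<tau> n))"
      using S_meas H(1) by (rule borel_measurable_times)
    \<comment> \<open>The cross term: \<open>?S n * H n\<close> is known at time
      \<open>\<tau> n\<close>, hence independent of the centred variable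
      \<open>\<xi> \<tau> n\<close>.\<close>
    have prod: "integrable M (\<lambda>\<omega>. ?S n \<omega> * H n \<omega> * \<xi> \<tau> n \<omega>)"
      "expectation (\<lambda>\<omega>. ?S n \<omega> * H n \<omega> * \<xi> \<tau> n \<omega>) = 0"
      using increment_product[OF SH_F SH_int \<tau>_nonneg \<tau>(2) \<phi>] \<xi>_int[of n] \<xi>(2)[of n]
      unfolding \<xi>_def by auto
    have sq_int: "integrable M (\<lambda>\<omega>. (H n \<omega> * \<xi> \<tau> n \<omega>)\<^sup>2)"
      by (rule Bochner_Integration.integrable_bound[where f="\<lambda>\<omega>. C\<^sup>2 * (\<xi> \<tau> n \<omega>)\<^sup>2"])
        (use \<xi>(1) H_M measurable_F_M[OF \<xi>_meas[of n "Suc n"]] HH in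
          \<open>auto simp: power_mult_distrib intro!: mult_right_mono\<close>)
    have sq_le: "expectation (\<lambda>\<omega>. (H n \<omega> * \<xi> \<tau> n \<omega>)\<^sup>2) \<le> C\<^sup>2 * v"
    proof -
      have "expectation (\<lambda>\<omega>. (H n \<omega> * \<xi> \<tau> n \<omega>)\<^sup>2) \<le> expectation (\<lambda>\<omega>. C\<^sup>2 * (\<xi> \<tau> n \<omega>)\<^sup>2)"
        by (intro integral_mono sq_int integrable_mult_right \<xi>(1))
          (auto simp: power_mult_distrib intro!: mult_right_mono HH)
      then show ?thesis using \<xi>(3) by simp
    qed
    have eq: "(?S (Suc n) \<omega>)\<^sup>2 = (?S n \<omega>)\<^sup>2 + 2 * (?S n \<omega> * H n \<omega> * \<xi> \<tau> n \<omega>) + (H n \<omega> * \<xi> \<tau> n \<omega>)\<^sup>2" for \<omega>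
      by (simp add: power2_sum algebra_simps)
    show ?case
      unfolding eq using Suc prod sq_int sq_le by (simp del: sum.lessThan_Suc) (simp add: algebra_simps)
  qed simp
  then show "integrable M (\<lambda>\<omega>. (?S n \<omega>)\<^sup>2)" "expectation (\<lambda>\<omega>. (?S n \<omega>)\<^sup>2) \<le> n * C\<^sup>2 * v"
    by auto
qed

end

subsection \<open>Sublinear growth of Brownian motion\<close>

text \<open>Fatou's lemma in the form that carries a bound uniform over dyadic grids to the
  limit.\<close>

lemma nn_integral_liminf_le:
  fixes Z :: "nat \<Rightarrow> 'a \<Rightarrow> ennreal"
  assumes "\<And>j. Z j \<in> borel_measurable M" "\<And>j. (\<integral>\<^sup>+x. Z j x \<partial>M) \<le> c"
  shows "(\<integral>\<^sup>+x. liminf (\<lambda>j. Z j x) \<partial>M) \<le> c"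
proof -
  have "(\<integral>\<^sup>+x. liminf (\<lambda>j. Z j x) \<partial>M) \<le> liminf (\<lambda>j. \<integral>\<^sup>+x. Z j x \<partial>M)"
    by (rule nn_integral_liminf) fact
  also have "\<dots> \<le> liminf (\<lambda>j. c)"
    by (rule Liminf_mono) (simp add: assms)
  finally show ?thesis by (simp add: Liminf_const)
qed

text \<open>Places each time between consecutive squares, the skeleton on which the moment bounds
  are summed.\<close>

lemma nat_floor_sqrt:
  fixes t :: real
  assumes "0 \<le> t"
  shows "(real (nat \<lfloor>sqrt t\<rfloor>))\<^sup>2 \<le> t" and "t \<le> (real (nat \<lfloor>sqrt t\<rfloor>) + 1)\<^sup>2"
proof -
  have *: "real (nat \<lfloor>sqrt t\<rfloor>) \<le> sqrt t" "sqrt t \<le> real (nat \<lfloor>sqrt t\<rfloor>) + 1"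
    using assms by (auto simp: of_nat_floor)
  then have "(real (nat \<lfloor>sqrt t\<rfloor>))\<^sup>2 \<le> (sqrt t)\<^sup>2" "(sqrt t)\<^sup>2 \<le> (real (nat \<lfloor>sqrt t\<rfloor>) + 1)\<^sup>2"
    using power_mono[OF *(1), of 2] power_mono[OF *(2), of 2] assms by simp_all
  then show "(real (nat \<lfloor>sqrt t\<rfloor>))\<^sup>2 \<le> t" "t \<le> (real (nat \<lfloor>sqrt t\<rfloor>) + 1)\<^sup>2"
    by (simp_all only: real_sqrt_pow2[OF assms])
qed

lemma filterlim_nat_floor_sqrt: "filterlim (\<lambda>t::real. nat \<lfloor>sqrt t\<rfloor>) at_top at_top"
  by (intro filterlim_compose[OF filterlim_nat_sequentially]
      filterlim_compose[OF filterlim_floor_sequentially] sqrt_at_top)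

section \<open>Grid maxima and Doob's inequality\<close>

primrec grid_max :: "(nat \<Rightarrow> real) \<Rightarrow> nat \<Rightarrow> real" where
  "grid_max f 0 = f 0"
| "grid_max f (Suc k) = max (grid_max f k) (f (Suc k))"

lemma grid_max_ge: "k \<le> n \<Longrightarrow> f k \<le> grid_max f n"
  by (induction n) (auto simp: le_Suc_eq)

lemma grid_max_eq: "\<exists>k\<le>n. grid_max f n = f k"
  by (induction n) (auto simp: max_def intro: le_SucI)

lemma grid_max_measurable:
  assumes "\<And>k. k \<le> n \<Longrightarrow> (\<lambda>\<omega>. f k \<omega>) \<in> borel_measurable N"
  shows "(\<lambda>\<omega>. grid_max (\<lambda>k. f k \<omega>) n) \<in> borel_measurable N"
  using assms by (induction n) auto

text \<open>A pathwise form of Doob's \<open>L\<^sup>2\<close> maximal inequality: the sum on the right is a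
  martingale transform.\<close>

lemma grid_max_square_le:
  assumes "f 0 = 0"
  shows "(grid_max f n)\<^sup>2 \<le> 4 * (f n)\<^sup>2 - 4 * (\<Sum>k<n. grid_max f k * (f (Suc k) - f k))"
proof -
  have "(grid_max f n)\<^sup>2 \<le> 2 * grid_max f n * f n - 2 * (\<Sum>k<n. grid_max f k * (f (Suc k) - f k))"
  proof (induction n)
    case (Suc n)
    \<comment> \<open>Equality if the maximum does not move; at a new maximum the two sides differ
      by exactly \<open>(x' - m)\<^sup>2\<close>.\<close>
    have "(max m x')\<^sup>2 - m\<^sup>2 \<le> 2 * max m x' * x' - 2 * m * x - 2 * m * (x' - x)" for m x x' :: real
    proof (cases "x' \<le> m")
      case False
      then have "0 \<le> (x' - m)\<^sup>2" by simp
      with False show ?thesis by (simp add: max_def power2_eq_square algebra_simps)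
    qed (simp add: max_def algebra_simps)
    from this[of "grid_max f n" "f (Suc n)" "f n"] Suc show ?case
      by (simp add: algebra_simps)
  qed (use assms in simp)
  \<comment> \<open>Young's inequality: \<open>2 * m * f\<close> is at most half of
    \<open>m\<^sup>2\<close> plus \<open>2 * f\<^sup>2\<close>. Moving that half to the left yields
    the constant 4.\<close>
  moreover have "0 \<le> (grid_max f n - 2 * f n)\<^sup>2" by simp
  ultimately show ?thesis by (simp add: power2_eq_square algebra_simps)
qed

context filtered_brownian_motion
begin

text \<open>Expectations are taken in \<open>grid_max_square_le\<close>, where the transform has
  mean zero. The sign \<open>\<sigma>\<close> is there because \<open>grid_max\<close> controls a
  path from one side only.\<close>

lemma grid_max_second_moment:
  assumes "0 < \<delta>" and "\<bar>\<sigma>\<bar> = 1"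
  defines "f \<equiv> \<lambda>\<omega> k. \<sigma> * (W (real k * \<delta>) \<omega> - W 0 \<omega>)"
  shows "integrable M (\<lambda>\<omega>. (grid_max (f \<omega>) n)\<^sup>2)"
    and "expectation (\<lambda>\<omega>. (grid_max (f \<omega>) n)\<^sup>2) \<le> 4 * (real n * \<delta>)"
proof -
  have \<sigma>2: "\<sigma>\<^sup>2 = 1" using assms(2) by (metis power2_abs one_power2)
  have f_F: "(\<lambda>\<omega>. f \<omega> k) \<in> borel_measurable (F (real n * \<delta>))" if "k \<le> n" for k n
    unfolding f_def
    by (intro borel_measurable_times borel_measurable_const increment_measurable_F)
      (use assms(1) that in \<open>auto intro!: mult_right_mono\<close>)
  have max_F: "(\<lambda>\<omega>. grid_max (f \<omega>) n) \<in> borel_measurable (F (real n * \<delta>))" for n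
    by (rule grid_max_measurable) (rule f_F)
  have f_sq: "integrable M (\<lambda>\<omega>. (f \<omega> k)\<^sup>2)" "expectation (\<lambda>\<omega>. (f \<omega> k)\<^sup>2) = real k * \<delta>" for k
    using increment_moments[of 0 "real k * \<delta>"] assms(1)
    by (cases "k = 0"; simp add: f_def power_mult_distrib \<sigma>2)+
  show max_sq: "integrable M (\<lambda>\<omega>. (grid_max (f \<omega>) n)\<^sup>2)" for n
  proof (rule Bochner_Integration.integrable_bound)
    show "integrable M (\<lambda>\<omega>. \<Sum>k\<le>n. (f \<omega> k)\<^sup>2)" using f_sq by auto
    show "(\<lambda>\<omega>. (grid_max (f \<omega>) n)\<^sup>2) \<in> borel_measurable M"
      using measurable_F_M[OF max_F] by measurable
    \<comment> \<open>The maximum is one of the grid values, so its square is one of the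
      summands.\<close>
    have "(grid_max (f \<omega>) n)\<^sup>2 \<le> (\<Sum>k\<le>n. (f \<omega> k)\<^sup>2)" for \<omega>
      using grid_max_eq[of n "f \<omega>"] by (auto intro!: member_le_sum)
    then show "AE \<omega> in M. norm ((grid_max (f \<omega>) n)\<^sup>2) \<le> norm (\<Sum>k\<le>n. (f \<omega> k)\<^sup>2)"
      by (auto simp: sum_nonneg intro!: AE_I2 order_trans[OF _ abs_ge_self])
  qed
  have max_int: "integrable M (\<lambda>\<omega>. grid_max (f \<omega>) n)" for n
    by (rule square_integrable_imp_integrable[OF measurable_F_M[OF max_F] max_sq])
  have diff: "f \<omega> (Suc k) - f \<omega> k = \<sigma> * (W (real (Suc k) * \<delta>) \<omega> - W (real k * \<delta>) \<omega>)" for \<omega> k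
    by (simp add: f_def algebra_simps)
  have prod: "integrable M (\<lambda>\<omega>. grid_max (f \<omega>) k * (f \<omega> (Suc k) - f \<omega> k))"
    "expectation (\<lambda>\<omega>. grid_max (f \<omega>) k * (f \<omega> (Suc k) - f \<omega> k)) = 0" for k
    using increment_product[OF max_F max_int, of k "real (Suc k) * \<delta>" "\<lambda>x. \<sigma> * x"] assms(1)
      increment_moments(1)[of "real k * \<delta>" "real (Suc k) * \<delta>" 1]
      increment_moments(2)[of "real k * \<delta>" "real (Suc k) * \<delta>"]
    unfolding diff by simp_all
  have "expectation (\<lambda>\<omega>. (grid_max (f \<omega>) n)\<^sup>2) \<le>
      expectation (\<lambda>\<omega>. 4 * (f \<omega> n)\<^sup>2 - 4 * (\<Sum>k<n. grid_max (f \<omega>) k * (f \<omega> (Suc k) - f \<omega> k)))"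
    by (intro integral_mono max_sq grid_max_square_le Bochner_Integration.integrable_diff
        integrable_mult_right Bochner_Integration.integrable_sum f_sq prod)
      (simp add: f_def)
  also have "\<dots> = 4 * (real n * \<delta>)"
    using f_sq prod by simp
  finally show "expectation (\<lambda>\<omega>. (grid_max (f \<omega>) n)\<^sup>2) \<le> 4 * (real n * \<delta>)" .
qed

text \<open>The grid maxima of both signs have second moments adding up to at most
  \<open>8 * T\<close>. Fatou removes the mesh, and path continuity extends the domination from grid
  points to all times. Asking only for a measurable dominating \<open>Z\<close> avoids the
  measurability of an uncountable supremum.\<close>

lemma sup_increment_bound:
  assumes "0 < T"
  obtains Z where "Z \<in> borel_measurable M" "(\<integral>\<^sup>+\<omega>. Z \<omega> \<partial>M) \<le> ennreal (8 * T)"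
    and "AE \<omega> in M. \<forall>t\<in>{0..T}. ennreal ((W t \<omega> - W 0 \<omega>)\<^sup>2) \<le> Z \<omega>"
proof -
  define \<delta> where "\<delta> j = T / 2 ^ j" for j :: nat
  define f where "f \<sigma> j \<omega> k = \<sigma> * (W (real k * \<delta> j) \<omega> - W 0 \<omega>)" for \<sigma> j \<omega> k
  define Z where "Z j \<omega> = ennreal ((grid_max (f 1 j \<omega>) (2 ^ j))\<^sup>2 + (grid_max (f (-1) j \<omega>) (2 ^ j))\<^sup>2)" for j \<omega>
  have \<delta>_pos: "0 < \<delta> j" for j using assms by (simp add: \<delta>_def)
  note mom = grid_max_second_moment[OF \<delta>_pos, folded f_def]
  have sm: "integrable M (\<lambda>\<omega>. (grid_max (f \<sigma> j \<omega>) (2 ^ j))\<^sup>2)"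
    "expectation (\<lambda>\<omega>. (grid_max (f \<sigma> j \<omega>) (2 ^ j))\<^sup>2) \<le> 4 * T" if "\<bar>\<sigma>\<bar> = 1" for \<sigma> j
    using mom[OF that, of j "2 ^ j"] by (auto simp: \<delta>_def)
  have Z_meas [measurable]: "Z j \<in> borel_measurable M" for j
    using sm(1)[of 1 j] sm(1)[of "-1" j] unfolding Z_def by measurable
  have Z_int: "(\<integral>\<^sup>+\<omega>. Z j \<omega> \<partial>M) \<le> ennreal (8 * T)" for j
  proof -
    have "(\<integral>\<^sup>+\<omega>. Z j \<omega> \<partial>M) = ennreal (expectation (\<lambda>\<omega>. (grid_max (f 1 j \<omega>) (2 ^ j))\<^sup>2 + (grid_max (f (-1) j \<omega>) (2 ^ j))\<^sup>2))"
      unfolding Z_def using sm(1)[of 1 j] sm(1)[of "-1" j] by (intro nn_integral_eq_integral) auto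
    also have "\<dots> \<le> ennreal (8 * T)"
      using sm[of 1 j] sm[of "-1" j] by (intro ennreal_leI) auto
    finally show ?thesis .
  qed
  show ?thesis
  proof
    show "(\<lambda>\<omega>. liminf (\<lambda>j. Z j \<omega>)) \<in> borel_measurable M" by measurable
    show "(\<integral>\<^sup>+\<omega>. liminf (\<lambda>j. Z j \<omega>) \<partial>M) \<le> ennreal (8 * T)"
      by (intro nn_integral_liminf_le Z_meas Z_int)
    have "AE \<omega> in M. continuous_on {0..} (\<lambda>t. W t \<omega>)"
      using brownian by (simp add: brownian_motion_def)
    then show "AE \<omega> in M. \<forall>t\<in>{0..T}. ennreal ((W t \<omega> - W 0 \<omega>)\<^sup>2) \<le> liminf (\<lambda>j. Z j \<omega>)"
    proof (eventually_elim, intro ballI)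
      fix \<omega> t assume cont: "continuous_on {0..} (\<lambda>t. W t \<omega>)" and t: "t \<in> {0..T}"
      \<comment> \<open>Index of the last grid point not after \<open>t\<close>; these grid points
        converge to \<open>t\<close>.\<close>
      define k where "k j = nat \<lfloor>t / \<delta> j\<rfloor>" for j
      have k: "real (k j) * \<delta> j \<le> t" "t - \<delta> j \<le> real (k j) * \<delta> j" "k j \<le> 2 ^ j" for j
      proof -
        have "0 \<le> t / \<delta> j" using t \<delta>_pos[of j] by auto
        then have "real (k j) \<le> t / \<delta> j" "t / \<delta> j - 1 \<le> real (k j)"
          unfolding k_def by linarith+
        then show "real (k j) * \<delta> j \<le> t" "t - \<delta> j \<le> real (k j) * \<delta> j"
          using \<delta>_pos[of j] by (auto simp: field_simps)
        have "t / \<delta> j \<le> T / \<delta> j" using t \<delta>_pos[of j] by (intro divide_right_mono) auto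
        also have "\<dots> = 2 ^ j" using assms by (simp add: \<delta>_def)
        finally have "t / \<delta> j \<le> 2 ^ j" .
        with \<open>real (k j) \<le> t / \<delta> j\<close> have "real (k j) \<le> real (2 ^ j)"
          unfolding of_nat_power of_nat_numeral by (rule order_trans)
        then show "k j \<le> 2 ^ j" unfolding of_nat_le_iff .
      qed
      have "(\<lambda>j. T * (1 / 2) ^ j) \<longlonglongrightarrow> T * 0"
        by (intro tendsto_mult tendsto_const LIMSEQ_power_zero) auto
      then have \<delta>_lim: "\<delta> \<longlonglongrightarrow> 0" by (simp add: \<delta>_def [abs_def] power_divide)
      have "(\<lambda>j. real (k j) * \<delta> j) \<longlonglongrightarrow> t"
      proof (rule tendsto_sandwich)
        show "(\<lambda>j. t - \<delta> j) \<longlonglongrightarrow> t" using tendsto_diff[OF tendsto_const \<delta>_lim, of t] by simp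
        show "(\<lambda>j. t) \<longlonglongrightarrow> t" by simp
      qed (use k in \<open>auto intro!: always_eventually\<close>)
      then have "(\<lambda>j. W (real (k j) * \<delta> j) \<omega>) \<longlonglongrightarrow> W t \<omega>"
        by (rule continuous_on_tendsto_compose[OF cont])
          (use t \<delta>_pos in \<open>auto intro!: always_eventually simp: less_imp_le\<close>)
      then have "(\<lambda>j. ennreal ((W (real (k j) * \<delta> j) \<omega> - W 0 \<omega>)\<^sup>2)) \<longlonglongrightarrow> ennreal ((W t \<omega> - W 0 \<omega>)\<^sup>2)"
        by (intro tendsto_ennrealI tendsto_power tendsto_diff tendsto_const)
      then have "ennreal ((W t \<omega> - W 0 \<omega>)\<^sup>2) = liminf (\<lambda>j. ennreal ((W (real (k j) * \<delta> j) \<omega> - W 0 \<omega>)\<^sup>2))"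
        by (intro lim_imp_Liminf[symmetric]) auto
      also have "\<dots> \<le> liminf (\<lambda>j. Z j \<omega>)"
      proof (intro Liminf_mono always_eventually allI)
        fix j
        let ?x = "W (real (k j) * \<delta> j) \<omega> - W 0 \<omega>"
        have "?x \<le> grid_max (f 1 j \<omega>) (2 ^ j)" "- ?x \<le> grid_max (f (-1) j \<omega>) (2 ^ j)"
          using grid_max_ge[OF k(3)[of j], of "f 1 j \<omega>"] grid_max_ge[OF k(3)[of j], of "f (-1) j \<omega>"]
          by (auto simp: f_def)
        then have "\<bar>?x\<bar> \<le> \<bar>grid_max (f 1 j \<omega>) (2 ^ j)\<bar> \<or> \<bar>?x\<bar> \<le> \<bar>grid_max (f (-1) j \<omega>) (2 ^ j)\<bar>"
          by linarith
        then have "?x\<^sup>2 \<le> (grid_max (f 1 j \<omega>) (2 ^ j))\<^sup>2 + (grid_max (f (-1) j \<omega>) (2 ^ j))\<^sup>2"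
          unfolding abs_le_square_iff by (auto intro: add_increasing add_increasing2)
        then show "ennreal (?x\<^sup>2) \<le> Z j \<omega>"
          unfolding Z_def by (rule ennreal_leI)
      qed
      finally show "ennreal ((W t \<omega> - W 0 \<omega>)\<^sup>2) \<le> liminf (\<lambda>j. Z j \<omega>)" .
    qed
  qed
qed

text \<open>After division by \<open>(T k)\<^sup>2\<close> the dominating variables have means of
  order \<open>1 / (k + 1)\<^sup>2\<close>, which are summable. Times between squares are covered
  because the bound is already one for the supremum over the interval up to
  \<open>T k\<close>.\<close>

lemma brownian_sublinear: "AE \<omega> in M. ((\<lambda>t. (W t \<omega> - W 0 \<omega>) / t) \<longlongrightarrow> 0) at_top"
proof -
  define T where "T k = (real k + 1)\<^sup>2" for k :: nat
  have T: "0 < T k" for k by (simp add: T_def)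
  have "\<forall>k. \<exists>Z. Z \<in> borel_measurable M \<and> (\<integral>\<^sup>+\<omega>. Z \<omega> \<partial>M) \<le> ennreal (8 * T k) \<and>
      (AE \<omega> in M. \<forall>t\<in>{0..T k}. ennreal ((W t \<omega> - W 0 \<omega>)\<^sup>2) \<le> Z \<omega>)"
    by (intro allI, rule sup_increment_bound[OF T]) blast
  from choice[OF this] obtain Z where Z [measurable]: "\<And>k. Z k \<in> borel_measurable M"
    and Z_int: "\<And>k. (\<integral>\<^sup>+\<omega>. Z k \<omega> \<partial>M) \<le> ennreal (8 * T k)"
    and Z_ge: "\<And>k. AE \<omega> in M. \<forall>t\<in>{0..T k}. ennreal ((W t \<omega> - W 0 \<omega>)\<^sup>2) \<le> Z k \<omega>"
    by blast
  have "AE \<omega> in M. (\<lambda>k. ennreal (1 / (T k)\<^sup>2) * Z k \<omega>) \<longlonglongrightarrow> 0"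
  proof (rule AE_tendsto_zero_of_summable)
    show "(\<integral>\<^sup>+\<omega>. ennreal (1 / (T k)\<^sup>2) * Z k \<omega> \<partial>M) \<le> ennreal (8 * (1 / (real (Suc k))\<^sup>2))" for k
    proof -
      have "(\<integral>\<^sup>+\<omega>. ennreal (1 / (T k)\<^sup>2) * Z k \<omega> \<partial>M) \<le> ennreal (1 / (T k)\<^sup>2) * ennreal (8 * T k)"
        by (subst nn_integral_cmult) (auto intro!: mult_left_mono Z_int)
      also have "\<dots> = ennreal (8 * (1 / T k))"
        using T[of k] by (simp flip: ennreal_mult add: power2_eq_square)
      finally show ?thesis by (simp add: T_def add.commute)
    qed
    show "summable (\<lambda>k. 8 * (1 / (real (Suc k))\<^sup>2))"
      using inverse_power_summable[of 2, where ?'a = real]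
      by (intro summable_mult) (subst summable_Suc_iff, simp add: inverse_eq_divide)
  qed auto
  moreover have "AE \<omega> in M. \<forall>k. \<forall>t\<in>{0..T k}. ennreal ((W t \<omega> - W 0 \<omega>)\<^sup>2) \<le> Z k \<omega>"
    using Z_ge by (simp add: AE_all_countable)
  ultimately show ?thesis
  proof eventually_elim
    case (elim \<omega>)
    show ?case
    proof (rule tendstoI)
      fix e :: real assume e: "0 < e"
      have "eventually (\<lambda>k. ennreal (1 / (T k)\<^sup>2) * Z k \<omega> < ennreal ((e / 4)\<^sup>2)) sequentially"
        using elim(1) e by (intro order_tendstoD) auto
      then have "eventually (\<lambda>t::real. ennreal (1 / (T (nat \<lfloor>sqrt t\<rfloor>))\<^sup>2) * Z (nat \<lfloor>sqrt t\<rfloor>) \<omega> < ennreal ((e / 4)\<^sup>2)) at_top"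
        using filterlim_nat_floor_sqrt by (rule eventually_compose_filterlim)
      then show "eventually (\<lambda>t. dist ((W t \<omega> - W 0 \<omega>) / t) 0 < e) at_top"
        using eventually_ge_at_top[of 1]
      proof eventually_elim
        case (elim t)
        define k where "k = nat \<lfloor>sqrt t\<rfloor>"
        let ?w = "\<bar>W t \<omega> - W 0 \<omega>\<bar>"
        have kt: "(real k)\<^sup>2 \<le> t" "t \<le> T k"
          using nat_floor_sqrt[of t] elim unfolding k_def T_def by auto
        have "1 \<le> sqrt t" using elim by simp
        then have "1 \<le> \<lfloor>sqrt t\<rfloor>" by (simp add: le_floor_iff)
        then have k1: "1 \<le> real k" unfolding k_def by linarith
        \<comment> \<open>This product is \<open>4 * k\<^sup>2 - (k + 1)\<^sup>2\<close>. The
          resulting factor 4 is the reason for the tolerance \<open>e / 4\<close> above.\<close>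
        have "0 \<le> (real k - 1) * (3 * real k + 1)" using k1 by (intro mult_nonneg_nonneg) auto
        then have T4: "T k \<le> 4 * t" using kt(1) by (simp add: T_def power2_eq_square algebra_simps)
        have "ennreal (1 / (T k)\<^sup>2 * ?w\<^sup>2) = ennreal (1 / (T k)\<^sup>2) * ennreal (?w\<^sup>2)"
          by (intro ennreal_mult) auto
        also have "\<dots> \<le> ennreal (1 / (T k)\<^sup>2) * Z k \<omega>"
          using \<open>\<forall>k. \<forall>t\<in>{0..T k}. _\<close> kt elim by (intro mult_left_mono) auto
        also have "\<dots> < ennreal ((e / 4)\<^sup>2)" using elim(1) unfolding k_def .
        finally have "(?w / T k)\<^sup>2 < (e / 4)\<^sup>2"
          by (simp add: ennreal_less_iff power_divide)
        then have "?w / T k < e / 4" by (rule power_less_imp_less_base) (use e in simp)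
        then have "?w < e / 4 * T k" using T[of k] by (simp add: field_simps)
        also have "\<dots> \<le> e / 4 * (4 * t)" using T4 e by (intro mult_left_mono) auto
        finally show ?case using elim by (simp add: field_simps)
      qed
    qed
  qed
qed

end

subsection \<open>The discrete Ito formula for reflected walks\<close>

text \<open>A Lipschitz second derivative makes the second-order Taylor remainder cubic, so that
  summed along a grid it is at most the step size times the quadratic variation. The condition
  \<open>p 0 = 1\<close> encodes the reflection at the running maximum.\<close>

locale barrier =
  fixes g p q :: "real \<Rightarrow> real" and P Q \<Lambda> :: real
  assumes g_deriv: "\<And>y. (g has_real_derivative p y) (at y)"
    and p_deriv: "\<And>y. (p has_real_derivative q y) (at y)"
    and g_0: "g 0 = 0" and p_0: "p 0 = 1"
    and p_bound: "\<And>y. \<bar>p y\<bar> \<le> P"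
    and q_bound: "\<And>y. \<bar>q y\<bar> \<le> Q"
    and q_lipschitz: "\<And>y z. \<bar>q y - q z\<bar> \<le> \<Lambda> * \<bar>y - z\<bar>"
begin

lemma constants_nonneg: "0 \<le> P" "0 \<le> Q" "0 \<le> \<Lambda>"
  using p_bound[of 0] q_bound[of 0] q_lipschitz[of 1 0] by auto

lemma p_lipschitz: "\<bar>p y - p z\<bar> \<le> Q * \<bar>y - z\<bar>"
  using field_differentiable_bound[of UNIV p q Q y z] p_deriv q_bound
  by (auto intro: has_field_derivative_at_within)

lemma g_lipschitz: "\<bar>g y - g z\<bar> \<le> P * \<bar>y - z\<bar>"
  using field_differentiable_bound[of UNIV g p P y z] g_deriv p_bound
  by (auto intro: has_field_derivative_at_within)

lemma taylor_p: "\<bar>p z - p y - q y * (z - y)\<bar> \<le> \<Lambda> * (z - y)\<^sup>2"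
proof -
  have "\<bar>(p z - q y * z) - (p y - q y * y)\<bar> \<le> \<Lambda> * \<bar>z - y\<bar> * \<bar>z - y\<bar>"
  proof (rule field_differentiable_bound[of "closed_segment y z" _ "\<lambda>u. q u - q y", unfolded real_norm_def])
    fix u assume u: "u \<in> closed_segment y z"
    show "((\<lambda>u. p u - q y * u) has_field_derivative q u - q y) (at u within closed_segment y z)"
      by (auto intro!: derivative_eq_intros has_field_derivative_at_within[OF p_deriv])
    have "\<bar>u - y\<bar> \<le> \<bar>z - y\<bar>" using segment_bound(1)[OF u] by simp
    then have "\<Lambda> * \<bar>u - y\<bar> \<le> \<Lambda> * \<bar>z - y\<bar>" using constants_nonneg by (intro mult_left_mono)
    then show "\<bar>q u - q y\<bar> \<le> \<Lambda> * \<bar>z - y\<bar>" using q_lipschitz[of u y] by linarith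
  qed auto
  then show ?thesis by (simp add: algebra_simps power2_eq_square abs_mult_self_eq)
qed

text \<open>Mean value inequality for \<open>g\<close> minus its Taylor polynomial, whose derivative
  is controlled by \<open>taylor_p\<close>.\<close>

lemma taylor_g: "\<bar>g (y + d) - g y - p y * d - q y * d\<^sup>2 / 2\<bar> \<le> \<Lambda> * \<bar>d\<bar> * d\<^sup>2"
proof -
  let ?G = "\<lambda>z. g z - p y * z - q y * (z - y)\<^sup>2 / 2"
  have "\<bar>?G (y + d) - ?G y\<bar> \<le> \<Lambda> * d\<^sup>2 * \<bar>(y + d) - y\<bar>"
  proof (rule field_differentiable_bound[of "closed_segment y (y + d)" _ "\<lambda>z. p z - p y - q y * (z - y)", unfolded real_norm_def])
    fix u assume u: "u \<in> closed_segment y (y + d)"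
    show "(?G has_field_derivative p u - p y - q y * (u - y)) (at u within closed_segment y (y + d))"
      by (auto intro!: derivative_eq_intros has_field_derivative_at_within[OF g_deriv])
    have "\<bar>u - y\<bar> \<le> \<bar>d\<bar>" using segment_bound(1)[OF u] by simp
    then have "\<Lambda> * (u - y)\<^sup>2 \<le> \<Lambda> * d\<^sup>2"
      using constants_nonneg by (intro mult_left_mono) (auto simp: abs_le_square_iff)
    then show "\<bar>p u - p y - q y * (u - y)\<bar> \<le> \<Lambda> * d\<^sup>2" using taylor_p[of u y] by linarith
  qed auto
  then show ?thesis by (simp add: algebra_simps)
qed

text \<open>The drawdown moves by \<open>?L - ?\<Delta>\<close>, where \<open>?L\<close> is the
  growth of the maximum. In the Taylor expansion the terms containing \<open>?L\<close> nearly
  cancel: \<open>?L > 0\<close> forces the old drawdown into the interval from 0 to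
  \<open>e\<close>, where \<open>p\<close> is close to \<open>p 0 = 1\<close>. The error is then a
  small multiple of \<open>?L\<close>, which telescopes in a sum.\<close>

lemma grid_step:
  assumes mx: "x \<le> m" and e: "\<bar>x' - x\<bar> \<le> e"
  defines "m' \<equiv> max m x'"
  shows "\<bar>(m' - g (m' - x')) - (m - g (m - x)) - (p (m - x) * (x' - x) - q (m - x) * (x' - x)\<^sup>2 / 2)\<bar>
    \<le> 2 * Q * e * (m' - m) + \<Lambda> * e * (x' - x)\<^sup>2"
proof -
  let ?y = "m - x" and ?\<Delta> = "x' - x" and ?L = "m' - m"
  define r where "r = g (?y + (?L - ?\<Delta>)) - g ?y - p ?y * (?L - ?\<Delta>) - q ?y * (?L - ?\<Delta>)\<^sup>2 / 2"
  have L: "0 \<le> ?L" "\<bar>?L - ?\<Delta>\<bar> \<le> \<bar>?\<Delta>\<bar>" using mx by (auto simp: m'_def max_def)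
  have "\<bar>r\<bar> \<le> \<Lambda> * \<bar>?L - ?\<Delta>\<bar> * (?L - ?\<Delta>)\<^sup>2" unfolding r_def by (rule taylor_g)
  also have "\<dots> \<le> \<Lambda> * e * ?\<Delta>\<^sup>2"
  proof (intro mult_mono)
    show "\<bar>?L - ?\<Delta>\<bar> \<le> e" using L(2) e by (rule order_trans)
    show "(?L - ?\<Delta>)\<^sup>2 \<le> ?\<Delta>\<^sup>2" using L(2) by (simp only: abs_le_square_iff)
  qed (use e constants_nonneg in auto)
  finally have r: "\<bar>r\<bar> \<le> \<Lambda> * e * ?\<Delta>\<^sup>2" .
  have main: "\<bar>?L * (1 - p ?y) - q ?y * ?L * (?L - 2 * ?\<Delta>) / 2\<bar> \<le> 2 * Q * e * ?L"
  proof (cases "?L = 0")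
    case False
    \<comment> \<open>At a new maximum \<open>x \<le> m < x'\<close>, so the old drawdown
      \<open>m - x\<close> is at most the step size \<open>e\<close>.\<close>
    then have m': "m' = x'" "m < x'" by (auto simp: m'_def max_def split: if_splits)
    then have "\<bar>1 - p ?y\<bar> \<le> Q * e"
      using p_lipschitz[of 0 ?y] p_0 mx e constants_nonneg
      by (auto intro: order_trans[OF _ mult_left_mono])
    moreover have "\<bar>q ?y * (?L - 2 * ?\<Delta>) / 2\<bar> \<le> Q * e"
    proof -
      have "\<bar>(?L - 2 * ?\<Delta>) / 2\<bar> \<le> e" using m' mx e by auto
      then have "\<bar>q ?y\<bar> * \<bar>(?L - 2 * ?\<Delta>) / 2\<bar> \<le> Q * e"
        using q_bound constants_nonneg by (intro mult_mono) auto
      then show ?thesis by (simp add: abs_mult)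
    qed
    ultimately have "\<bar>(1 - p ?y) - q ?y * (?L - 2 * ?\<Delta>) / 2\<bar> \<le> 2 * Q * e" by linarith
    then have "?L * \<bar>(1 - p ?y) - q ?y * (?L - 2 * ?\<Delta>) / 2\<bar> \<le> ?L * (2 * Q * e)"
      using L by (intro mult_left_mono)
    moreover have "?L * (1 - p ?y) - q ?y * ?L * (?L - 2 * ?\<Delta>) / 2 =
        ?L * ((1 - p ?y) - q ?y * (?L - 2 * ?\<Delta>) / 2)"
      by (simp add: algebra_simps)
    ultimately show ?thesis using L(1) by (simp add: abs_mult mult.commute)
  qed simp
  have y': "m' - x' = ?y + (?L - ?\<Delta>)" by simp
  have "(m' - g (m' - x')) - (m - g ?y) - (p ?y * ?\<Delta> - q ?y * ?\<Delta>\<^sup>2 / 2) =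
      ?L * (1 - p ?y) - q ?y * ?L * (?L - 2 * ?\<Delta>) / 2 - r"
    unfolding y' r_def by (simp add: power2_eq_square field_simps)
  then show ?thesis using main r by linarith
qed

text \<open>Summation of \<open>grid_step\<close>: the growths of the maximum telescope, so the
  reflection error is \<open>e\<close> times the total growth, whatever the number of steps.\<close>

lemma grid_expansion:
  fixes x :: "nat \<Rightarrow> real"
  assumes "\<And>k. k < n \<Longrightarrow> \<bar>x (Suc k) - x k\<bar> \<le> e"
  shows "\<bar>grid_max x n - g (grid_max x n - x n) - x 0
      - (\<Sum>k<n. p (grid_max x k - x k) * (x (Suc k) - x k)
                 - q (grid_max x k - x k) * (x (Suc k) - x k)\<^sup>2 / 2)\<bar>
    \<le> 2 * Q * e * (grid_max x n - x 0) + \<Lambda> * e * (\<Sum>k<n. (x (Suc k) - x k)\<^sup>2)"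
  using assms
proof (induction n)
  case 0
  then show ?case by (simp add: g_0)
next
  case (Suc n)
  have "\<bar>x (Suc n) - x n\<bar> \<le> e" using Suc.prems by simp
  from grid_step[OF grid_max_ge[OF order_refl, of x n] this] Suc.IH Suc.prems
  show ?case by (simp add: algebra_simps)
qed

end

section \<open>Deterministic estimates for a single path of the diffusion\<close>

locale drawdown_path =
  fixes a b c \<gamma> x0 :: real and x w :: "real \<Rightarrow> real"
  assumes a_pos: "0 < a" and b_pos: "0 < b" and c_pos: "0 < c" and \<gamma>_pos: "0 < \<gamma>"
    and x_cont: "continuous_on {0..} x"
    and drift_integrable: "\<And>t. 0 \<le> t \<Longrightarrow> set_integrable lborel {0..t} (\<lambda>s. drawdown_drift b c \<gamma> s x)"
    and x_eq: "\<And>t. 0 \<le> t \<Longrightarrow>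
      x t = x0 + sqrt a * w t + (LINT s:{0..t}|lborel. drawdown_drift b c \<gamma> s x)"
begin

abbreviation "\<beta> s \<equiv> drawdown_drift b c \<gamma> s x"
abbreviation "drawdown t \<equiv> running_max x t - x t"

lemma \<beta>_bounds: "0 \<le> \<beta> s" "\<beta> s \<le> max b c"
  using b_pos c_pos by (auto simp: drawdown_drift_def)

text \<open>Monotonicity of the integral over one time interval, with an affine function of the
  drift so that one lemma serves twice: constant bounds give the growth of \<open>x\<close>, and
  frozen values of \<open>p\<close> and \<open>q\<close> as coefficients give the integrated
  supersolution inequality.\<close>

lemma drift_increment:
  assumes uv: "0 \<le> u" "u \<le> v" and bound: "\<And>s. u \<le> s \<Longrightarrow> s \<le> v \<Longrightarrow> l \<le> \<alpha> * \<beta> s + \<kappa>"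
  shows "l * (v - u) \<le> \<alpha> * (x v - x u - sqrt a * (w v - w u)) + \<kappa> * (v - u)"
proof -
  have int: "set_integrable lborel {0..u} \<beta>" "set_integrable lborel {u<..v} \<beta>"
    using uv by (auto intro!: set_integrable_subset[OF drift_integrable[of v]])
  have "{0..v} = {0..u} \<union> {u<..v}" using uv by auto
  then have "(LINT s:{0..v}|lborel. \<beta> s) = (LINT s:{0..u}|lborel. \<beta> s) + (LINT s:{u<..v}|lborel. \<beta> s)"
    using set_integral_Un[OF _ int] by (metis Int_emptyI atLeastAtMost_iff greaterThanAtMost_iff not_le)
  then have eq: "x v - x u - sqrt a * (w v - w u) = (LINT s:{u<..v}|lborel. \<beta> s)"
    using x_eq[of v] x_eq[of u] uv by (simp add: algebra_simps)
  have const: "set_integrable lborel {u<..v} (\<lambda>s. r)" "(LINT s:{u<..v}|lborel. r) = r * (v - u)" for r :: real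
    using uv by (auto simp: set_integrable_def set_lebesgue_integral_def)
  have "(LINT s:{u<..v}|lborel. l) \<le> (LINT s:{u<..v}|lborel. \<alpha> * \<beta> s + \<kappa>)"
    by (rule set_integral_mono) (use const int bound in \<open>auto intro!: set_integral_add\<close>)
  also have "\<dots> = \<alpha> * (LINT s:{u<..v}|lborel. \<beta> s) + \<kappa> * (v - u)"
    using int const by (simp add: set_integral_add)
  finally show ?thesis by (simp add: const eq)
qed

lemma drift_increment_bounds:
  assumes uv: "0 \<le> u" "u \<le> v"
  shows "0 \<le> x v - x u - sqrt a * (w v - w u)"
    and "x v - x u - sqrt a * (w v - w u) \<le> max b c * (v - u)"
  using drift_increment[OF uv, of 0 1 0] drift_increment[OF uv, of "- max b c" "-1" 0] \<beta>_bounds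
  by auto

lemma running_max_bdd: "0 \<le> t \<Longrightarrow> bdd_above (x ` {0..t})"
  by (intro bounded_imp_bdd_above compact_imp_bounded compact_continuous_image
      continuous_on_subset[OF x_cont]) auto

lemma running_max_ge: "0 \<le> s \<Longrightarrow> s \<le> t \<Longrightarrow> x s \<le> running_max x t"
  unfolding running_max_def by (intro cSUP_upper running_max_bdd) auto

lemma running_max_le: "0 \<le> t \<Longrightarrow> (\<And>s. 0 \<le> s \<Longrightarrow> s \<le> t \<Longrightarrow> x s \<le> C) \<Longrightarrow> running_max x t \<le> C"
  unfolding running_max_def by (intro cSUP_least) auto

lemma drawdown_nonneg: "0 \<le> t \<Longrightarrow> 0 \<le> drawdown t"
  using running_max_ge[of t t] by simp

text \<open>The drift is nonnegative, so \<open>x\<close> can fall only as far as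
  \<open>sqrt a * w\<close> falls. Sublinearity of the driving path thus passes to the
  drawdown.\<close>

lemma drawdown_le:
  assumes t: "0 \<le> t" and w: "\<And>s. 0 \<le> s \<Longrightarrow> s \<le> t \<Longrightarrow> \<bar>w s - w 0\<bar> \<le> \<eta>"
  shows "drawdown t \<le> sqrt a * (2 * \<eta>)"
proof -
  have "running_max x t \<le> x t + sqrt a * (2 * \<eta>)"
  proof (rule running_max_le[OF t])
    fix s assume s: "0 \<le> s" "s \<le> t"
    have "w s - w t \<le> 2 * \<eta>" using w[of s] w[of t] s t by auto
    then have "sqrt a * (w s - w t) \<le> sqrt a * (2 * \<eta>)" using a_pos by (intro mult_left_mono) auto
    then show "x s \<le> x t + sqrt a * (2 * \<eta>)"
      using drift_increment_bounds(1)[OF s] by (simp add: algebra_simps)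
  qed
  then show ?thesis by simp
qed

text \<open>Every time up to \<open>s\<close> lies within one mesh width after a grid point of index
  at most \<open>k\<close>, so the grid misses at most one oscillation \<open>e\<close>.\<close>

lemma grid_max_running_max:
  assumes "0 < \<delta>" and s: "real k * \<delta> \<le> s" "s \<le> real k * \<delta> + \<delta>" "s \<le> T"
    and osc: "\<And>u v. 0 \<le> u \<Longrightarrow> u \<le> v \<Longrightarrow> v \<le> T \<Longrightarrow> v - u \<le> \<delta> \<Longrightarrow> \<bar>x v - x u\<bar> \<le> e"
  shows "grid_max (\<lambda>i. x (real i * \<delta>)) k \<le> running_max x s"
    and "running_max x s \<le> grid_max (\<lambda>i. x (real i * \<delta>)) k + e"
proof -
  have k0: "0 \<le> real k * \<delta>" using assms(1) by simp
  show "grid_max (\<lambda>i. x (real i * \<delta>)) k \<le> running_max x s"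
  proof -
    obtain i where i: "i \<le> k" "grid_max (\<lambda>i. x (real i * \<delta>)) k = x (real i * \<delta>)"
      using grid_max_eq by blast
    have "real i * \<delta> \<le> real k * \<delta>" using i assms(1) by (intro mult_right_mono) auto
    with s(1) have "real i * \<delta> \<le> s" by linarith
    then show ?thesis using i assms(1) by (auto intro!: running_max_ge)
  qed
  show "running_max x s \<le> grid_max (\<lambda>i. x (real i * \<delta>)) k + e"
  proof (rule running_max_le)
    fix u assume u: "0 \<le> u" "u \<le> s"
    \<comment> \<open>As \<open>s\<close> may coincide with grid point \<open>k + 1\<close>, the
      index is capped at \<open>k\<close>; the distance to \<open>u\<close> is still at most one
      mesh width.\<close>
    define i where "i = min k (nat \<lfloor>u / \<delta>\<rfloor>)"
    have "0 \<le> u / \<delta>" using u assms(1) by simp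
    then have "real (nat \<lfloor>u / \<delta>\<rfloor>) \<le> u / \<delta>" "u / \<delta> \<le> real (nat \<lfloor>u / \<delta>\<rfloor>) + 1" by linarith+
    then have *: "real (nat \<lfloor>u / \<delta>\<rfloor>) * \<delta> \<le> u" "u \<le> real (nat \<lfloor>u / \<delta>\<rfloor>) * \<delta> + \<delta>"
      using assms(1) by (auto simp: field_simps)
    have "real i * \<delta> \<le> real (nat \<lfloor>u / \<delta>\<rfloor>) * \<delta>" using assms(1) by (intro mult_right_mono) (auto simp: i_def)
    moreover have "u - real i * \<delta> \<le> \<delta>" using * s u by (auto simp: i_def min_def)
    moreover have "real i * \<delta> \<le> u" using calculation(1) *(1) by (rule order_trans)
    ultimately have "\<bar>x u - x (real i * \<delta>)\<bar> \<le> e" using * s u assms(1) by (intro osc) auto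
    moreover have "x (real i * \<delta>) \<le> grid_max (\<lambda>i. x (real i * \<delta>)) k"
      by (rule grid_max_ge[of i k "\<lambda>i. x (real i * \<delta>)"]) (simp add: i_def)
    ultimately show "x u \<le> grid_max (\<lambda>i. x (real i * \<delta>)) k + e" by linarith
  qed (use k0 s in linarith)
qed

end

section \<open>The supersolution inequality along a grid\<close>

text \<open>The sign \<open>\<sigma> = \<plusminus>1\<close> lets one argument serve for the lower and the upper bound of the speed.\<close>

locale drawdown_barrier = drawdown_path a b c \<gamma> x0 x w + barrier g p q P Q \<Lambda>
  for a b c \<gamma> x0 x w g p q P Q \<Lambda> +
  fixes \<sigma> l :: real
  assumes \<sigma>: "\<bar>\<sigma>\<bar> = 1"
    and supersolution: "\<And>y. 0 \<le> y \<Longrightarrow> \<sigma> * l \<le> \<sigma> * ((if y < \<gamma> then b else c) * p y - a / 2 * q y)"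
begin

text \<open>The inequality holds at the true drawdown at each time of the interval. Freezing the
  argument of \<open>p\<close> and \<open>q\<close> at the grid value \<open>y\<close> costs a
  multiple of \<open>e\<close>, by their Lipschitz bounds. The drift \<open>\<beta> s\<close> keeps
  its true value, so its jump at \<open>\<gamma>\<close> causes no error.\<close>

lemma drift_piece:
  assumes "0 < \<delta>" "real (Suc k) * \<delta> \<le> T" "0 \<le> e"
    and osc: "\<And>u v. 0 \<le> u \<Longrightarrow> u \<le> v \<Longrightarrow> v \<le> T \<Longrightarrow> v - u \<le> \<delta> \<Longrightarrow> \<bar>x v - x u\<bar> \<le> e"
  defines "t \<equiv> \<lambda>k. real k * \<delta>"
  defines "y \<equiv> grid_max (\<lambda>i. x (t i)) k - x (t k)"
  shows "(\<sigma> * l - (2 * Q * max b c + a * \<Lambda>) * e) * \<delta>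
    \<le> \<sigma> * (p y * (x (t (Suc k)) - x (t k) - sqrt a * (w (t (Suc k)) - w (t k))) - a / 2 * q y * \<delta>)"
proof -
  have tt: "0 \<le> t k" "t k \<le> t (Suc k)" "t (Suc k) = t k + \<delta>" "t (Suc k) \<le> T"
    using assms(1,2) by (auto simp: t_def algebra_simps)
  have "(\<sigma> * l - (2 * Q * max b c + a * \<Lambda>) * e) * (t (Suc k) - t k) \<le>
    \<sigma> * p y * (x (t (Suc k)) - x (t k) - sqrt a * (w (t (Suc k)) - w (t k))) + (- \<sigma> * a / 2 * q y) * (t (Suc k) - t k)"
  proof (rule drift_increment)
    fix s assume s: "t k \<le> s" "s \<le> t (Suc k)"
    have s0: "0 \<le> s" using s tt by linarith
    have "\<bar>x s - x (t k)\<bar> \<le> e" using s tt by (intro osc) auto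
    moreover have "grid_max (\<lambda>i. x (t i)) k \<le> running_max x s"
      "running_max x s \<le> grid_max (\<lambda>i. x (t i)) k + e"
      using grid_max_running_max[OF assms(1) _ _ _ osc, of k s] s tt unfolding t_def by auto
    \<comment> \<open>One \<open>e\<close> for the running maximum and one for the position.\<close>
    ultimately have y: "\<bar>y - drawdown s\<bar> \<le> 2 * e"
      unfolding y_def by linarith
    have "\<bar>p y - p (drawdown s)\<bar> \<le> Q * (2 * e)" "\<bar>q y - q (drawdown s)\<bar> \<le> \<Lambda> * (2 * e)"
      using order_trans[OF p_lipschitz mult_left_mono[OF y]] order_trans[OF q_lipschitz mult_left_mono[OF y]]
        constants_nonneg by auto
    then have "\<bar>\<beta> s * (p y - p (drawdown s))\<bar> \<le> max b c * (Q * (2 * e))"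
      "\<bar>a / 2 * (q y - q (drawdown s))\<bar> \<le> a / 2 * (\<Lambda> * (2 * e))"
      unfolding abs_mult using \<beta>_bounds[of s] a_pos by (auto intro!: mult_mono)
    then have "\<bar>(\<beta> s * p y - a / 2 * q y) - (\<beta> s * p (drawdown s) - a / 2 * q (drawdown s))\<bar>
        \<le> (2 * Q * max b c + a * \<Lambda>) * e"
      by (simp add: algebra_simps)
    moreover have "\<sigma> * l \<le> \<sigma> * (\<beta> s * p (drawdown s) - a / 2 * q (drawdown s))"
      using supersolution[OF drawdown_nonneg[OF s0]]
      by (auto simp: drawdown_drift_def algebra_simps split: if_splits)
    moreover have "\<sigma> * p y * \<beta> s + - \<sigma> * a / 2 * q y = \<sigma> * (\<beta> s * p y - a / 2 * q y)"
      by (simp add: algebra_simps)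
    moreover have "\<sigma> = 1 \<or> \<sigma> = -1" using \<sigma> by linarith
    ultimately show "\<sigma> * l - (2 * Q * max b c + a * \<Lambda>) * e \<le> \<sigma> * p y * \<beta> s + - \<sigma> * a / 2 * q y"
      by (elim disjE) (simp_all add: abs_le_iff mult.commute[of "p y" "\<beta> s"])
  qed (use tt in auto)
  then show ?thesis using tt by (simp add: algebra_simps)
qed

end

context drawdown_barrier
begin

lemma abs_\<sigma>: "\<bar>\<sigma> * z\<bar> = \<bar>z\<bar>"
  using \<sigma> by (simp add: abs_mult)

text \<open>Combines \<open>grid_expansion\<close> with \<open>drift_piece\<close>. Squared
  increments of \<open>x\<close> are traded for \<open>a\<close> times those of \<open>w\<close>,
  and these for \<open>\<delta>\<close>; the second exchange leaves the centred sum weighted by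
  \<open>q\<close>. What remains besides the martingale transform is of order \<open>e\<close> or
  \<open>\<delta>\<close>. The hypothesis \<open>V\<close> bounds the quadratic variation of
  \<open>x\<close>, which the Taylor error multiplies by \<open>e\<close>.\<close>

lemma grid_bound:
  assumes \<delta>: "0 < \<delta>" "real n * \<delta> = T" and e: "0 \<le> e" "e \<le> 1"
    and osc: "\<And>u v. 0 \<le> u \<Longrightarrow> u \<le> v \<Longrightarrow> v \<le> T \<Longrightarrow> v - u \<le> \<delta> \<Longrightarrow> \<bar>x v - x u\<bar> \<le> e"
  defines "t \<equiv> \<lambda>k. real k * \<delta>"
  defines "y \<equiv> \<lambda>k. grid_max (\<lambda>i. x (t i)) k - x (t k)"
    and "dw \<equiv> \<lambda>k. w (t (Suc k)) - w (t k)"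
  assumes V: "(\<Sum>k<n. (dw k)\<^sup>2 - \<delta>) \<le> 1"
  shows "\<sigma> * l * T + \<sigma> * sqrt a * (\<Sum>k<n. p (y k) * dw k)
      - a / 2 * \<bar>\<Sum>k<n. q (y k) * ((dw k)\<^sup>2 - \<delta>)\<bar> - Q * (max b c)\<^sup>2 * T / 2 * \<delta>
      - (1 + P + 2 * Q * (running_max x T - x 0) + \<Lambda> * (a + a * T + 2 * max b c * T)
          + (2 * Q * max b c + a * \<Lambda>) * T + Q * max b c * T) * e
    \<le> \<sigma> * (running_max x T - g (drawdown T) - x 0)"
proof -
  define B where "B = max b c"
  define \<Delta> where "\<Delta> k = x (t (Suc k)) - x (t k)" for k
  define D where "D k = \<Delta> k - sqrt a * dw k" for k
  define C where "C = 2 * Q * B + a * \<Lambda>"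
  define m where "m = grid_max (\<lambda>i. x (t i))"
  define A where "A k = p (y k) * \<Delta> k - q (y k) * (\<Delta> k)\<^sup>2 / 2" for k
  note const = constants_nonneg
  have B: "0 < B" using b_pos by (simp add: B_def)
  have T: "0 \<le> T" using \<delta> by auto
  have t_Suc: "t (Suc k) = t k + \<delta>" for k by (simp add: t_def algebra_simps)
  have t_le: "t k \<le> T" if "k \<le> n" for k
    using that \<delta> by (auto simp: t_def intro!: mult_right_mono)
  have t0: "0 \<le> t k" for k using \<delta>(1) by (simp add: t_def)
  have \<Delta>: "\<bar>\<Delta> k\<bar> \<le> e" if "k < n" for k
    unfolding \<Delta>_def using t_le[of "Suc k"] that t0 t_Suc \<delta>(1) by (intro osc) auto
  have D: "0 \<le> D k" "D k \<le> B * \<delta>" for k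
    using drift_increment_bounds[of "t k" "t (Suc k)"] t0 t_Suc \<delta>(1)
    by (auto simp: D_def \<Delta>_def dw_def B_def)
  have dw: "a * (dw k)\<^sup>2 = (\<Delta> k)\<^sup>2 - 2 * \<Delta> k * D k + (D k)\<^sup>2" for k
  proof -
    have "a * (dw k)\<^sup>2 = (sqrt a * dw k)\<^sup>2" using a_pos by (simp add: power_mult_distrib)
    also have "sqrt a * dw k = \<Delta> k - D k" by (simp add: D_def)
    finally show ?thesis by (simp add: power2_diff algebra_simps)
  qed
  have \<Delta>D: "\<bar>2 * \<Delta> k * D k\<bar> \<le> 2 * e * B * \<delta>" if "k < n" for k
  proof -
    have "\<bar>\<Delta> k\<bar> * \<bar>D k\<bar> \<le> e * (B * \<delta>)" using \<Delta>[OF that] D[of k] e by (intro mult_mono) auto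
    then show ?thesis by (simp add: abs_mult)
  qed
  have D2: "(D k)\<^sup>2 \<le> B\<^sup>2 * \<delta> * \<delta>" for k
    using power_mono[OF D(2) D(1), of k 2] by (simp add: power2_eq_square algebra_simps)
  have step: "\<sigma> * sqrt a * (p (y k) * dw k) + (\<sigma> * l - C * e) * \<delta>
      - \<sigma> * (a / 2) * (q (y k) * ((dw k)\<^sup>2 - \<delta>)) - Q / 2 * (2 * e * B * \<delta> + B\<^sup>2 * \<delta> * \<delta>) \<le> \<sigma> * A k"
    if k: "k < n" for k
  proof -
    have 1: "(\<sigma> * l - C * e) * \<delta> \<le> \<sigma> * (p (y k) * D k - a / 2 * q (y k) * \<delta>)"
      using drift_piece[OF \<delta>(1) _ e(1) osc, of k] t_le[of "Suc k"] k
      by (simp add: C_def B_def D_def \<Delta>_def dw_def y_def t_def)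
    have "\<bar>q (y k)\<bar> * \<bar>(D k)\<^sup>2 - 2 * \<Delta> k * D k\<bar> \<le> Q * (2 * e * B * \<delta> + B\<^sup>2 * \<delta> * \<delta>)"
      using \<Delta>D[OF k] D2[of k] q_bound const(2) zero_le_power2[of "D k"]
      by (intro mult_mono) (linarith | simp)+
    then have "\<bar>\<sigma> * (q (y k) * ((D k)\<^sup>2 - 2 * \<Delta> k * D k))\<bar> \<le> Q * (2 * e * B * \<delta> + B\<^sup>2 * \<delta> * \<delta>)"
      by (subst abs_\<sigma>, subst abs_mult)
    then have 2: "- (Q / 2 * (2 * e * B * \<delta> + B\<^sup>2 * \<delta> * \<delta>)) \<le> \<sigma> * (q (y k) * ((D k)\<^sup>2 - 2 * \<Delta> k * D k) / 2)"
      by (simp add: abs_le_iff)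
    \<comment> \<open>Four parts: martingale increment, generator term bounded by
      \<open>drift_piece\<close>, centred squared increment, and the contribution of the drift
      displacement \<open>D k\<close> to the squared step.\<close>
    have "A k = sqrt a * (p (y k) * dw k) + (p (y k) * D k - a / 2 * q (y k) * \<delta>)
        - a / 2 * (q (y k) * ((dw k)\<^sup>2 - \<delta>)) + q (y k) * (a * (dw k)\<^sup>2 - (\<Delta> k)\<^sup>2) / 2"
      by (simp add: A_def D_def field_simps)
    also have "a * (dw k)\<^sup>2 - (\<Delta> k)\<^sup>2 = (D k)\<^sup>2 - 2 * \<Delta> k * D k" by (simp add: dw)
    finally have "\<sigma> * A k = \<sigma> * sqrt a * (p (y k) * dw k) + \<sigma> * (p (y k) * D k - a / 2 * q (y k) * \<delta>)
        - \<sigma> * (a / 2) * (q (y k) * ((dw k)\<^sup>2 - \<delta>)) + \<sigma> * (q (y k) * ((D k)\<^sup>2 - 2 * \<Delta> k * D k) / 2)"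
      by (simp only: distrib_left right_diff_distrib mult.assoc)
    then show ?thesis using 1 2 by linarith
  qed
  let ?Vq = "\<Sum>k<n. q (y k) * ((dw k)\<^sup>2 - \<delta>)"
  have "(\<Sum>k<n. \<sigma> * sqrt a * (p (y k) * dw k) + (\<sigma> * l - C * e) * \<delta>
      - \<sigma> * (a / 2) * (q (y k) * ((dw k)\<^sup>2 - \<delta>)) - Q / 2 * (2 * e * B * \<delta> + B\<^sup>2 * \<delta> * \<delta>)) \<le> (\<Sum>k<n. \<sigma> * A k)"
    using step by (intro sum_mono) auto
  then have "\<sigma> * sqrt a * (\<Sum>k<n. p (y k) * dw k) + (\<sigma> * l - C * e) * T
      - \<sigma> * (a / 2) * ?Vq - Q / 2 * (2 * e * B * T + B\<^sup>2 * \<delta> * T) \<le> \<sigma> * (\<Sum>k<n. A k)"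
    unfolding \<delta>(2)[symmetric]
    by (simp only: sum.distrib sum_subtractf sum_distrib_left[symmetric] sum_constant card_lessThan)
  moreover have "\<sigma> * (a / 2) * ?Vq \<le> a / 2 * \<bar>?Vq\<bar>"
    using mult_left_mono[OF abs_ge_self[of "\<sigma> * ?Vq", unfolded abs_\<sigma>], of "a / 2"] a_pos
    by (simp add: mult.left_commute mult.assoc)
  ultimately have A: "\<sigma> * sqrt a * (\<Sum>k<n. p (y k) * dw k) + (\<sigma> * l - C * e) * T
      - a / 2 * \<bar>?Vq\<bar> - Q / 2 * (2 * e * B * T + B\<^sup>2 * \<delta> * T) \<le> \<sigma> * (\<Sum>k<n. A k)"
    by linarith
  have m_run: "m n \<le> running_max x T" "running_max x T \<le> m n + e"
    using grid_max_running_max[OF \<delta>(1) _ _ _ osc, of n T] \<delta> by (auto simp: m_def t_def)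
  \<comment> \<open>Quadratic variation of \<open>x\<close>, bounded uniformly in the mesh thanks to
    \<open>V\<close> and \<open>e \<le> 1\<close>.\<close>
  have sq: "(\<Sum>k<n. (\<Delta> k)\<^sup>2) \<le> a + a * T + 2 * B * T"
  proof -
    have "(\<Delta> k)\<^sup>2 \<le> a * ((dw k)\<^sup>2 - \<delta>) + a * \<delta> + 2 * e * B * \<delta>" if "k < n" for k
      using \<Delta>D[OF that] dw[of k] zero_le_power2[of "D k"]
      unfolding right_diff_distrib by linarith
    then have "(\<Sum>k<n. (\<Delta> k)\<^sup>2) \<le> (\<Sum>k<n. a * ((dw k)\<^sup>2 - \<delta>) + a * \<delta> + 2 * e * B * \<delta>)"
      by (intro sum_mono) auto
    also have "\<dots> = a * (\<Sum>k<n. (dw k)\<^sup>2 - \<delta>) + a * T + 2 * e * B * T"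
      unfolding sum.distrib sum_distrib_left[symmetric] by (simp flip: \<delta>(2))
    also have "\<dots> \<le> a * 1 + a * T + 2 * 1 * B * T"
      using V a_pos e B T by (intro add_mono mult_left_mono mult_right_mono) auto
    finally show ?thesis by simp
  qed
  have "\<bar>m n - g (y n) - x 0 - (\<Sum>k<n. A k)\<bar>
      \<le> 2 * Q * e * (m n - x 0) + \<Lambda> * e * (\<Sum>k<n. (\<Delta> k)\<^sup>2)"
    using grid_expansion[of n "\<lambda>i. x (t i)" e] \<Delta>
    by (simp add: m_def y_def A_def \<Delta>_def) (simp add: t_def)
  also have "\<dots> \<le> 2 * Q * e * (running_max x T - x 0) + \<Lambda> * e * (a + a * T + 2 * B * T)"
    using m_run sq e const by (intro add_mono mult_left_mono) auto
  finally have E1: "\<bar>m n - g (y n) - x 0 - (\<Sum>k<n. A k)\<bar>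
      \<le> 2 * Q * e * (running_max x T - x 0) + \<Lambda> * e * (a + a * T + 2 * B * T)" .
  have "\<bar>y n - drawdown T\<bar> \<le> e" using m_run \<delta>(2) by (simp add: y_def m_def t_def)
  then have "\<bar>g (y n) - g (drawdown T)\<bar> \<le> P * e"
    using g_lipschitz[of "y n" "drawdown T"] const(1) by (meson mult_left_mono order_trans)
  with E1 m_run have "\<bar>running_max x T - g (drawdown T) - x 0 - (\<Sum>k<n. A k)\<bar>
      \<le> e + P * e + (2 * Q * e * (running_max x T - x 0) + \<Lambda> * e * (a + a * T + 2 * B * T))"
    by linarith
  then have "\<bar>\<sigma> * (running_max x T - g (drawdown T) - x 0) - \<sigma> * (\<Sum>k<n. A k)\<bar>
      \<le> e + P * e + (2 * Q * e * (running_max x T - x 0) + \<Lambda> * e * (a + a * T + 2 * B * T))"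
    using abs_\<sigma>[of "running_max x T - g (drawdown T) - x 0 - (\<Sum>k<n. A k)"]
    by (simp add: right_diff_distrib)
  then have "\<sigma> * (\<Sum>k<n. A k) - (e + P * e + (2 * Q * e * (running_max x T - x 0) + \<Lambda> * e * (a + a * T + 2 * B * T)))
      \<le> \<sigma> * (running_max x T - g (drawdown T) - x 0)"
    by (simp add: abs_le_iff)
  with A have "\<sigma> * sqrt a * (\<Sum>k<n. p (y k) * dw k) + (\<sigma> * l - C * e) * T
      - a / 2 * \<bar>?Vq\<bar> - Q / 2 * (2 * e * B * T + B\<^sup>2 * \<delta> * T)
      - (e + P * e + (2 * Q * e * (running_max x T - x 0) + \<Lambda> * e * (a + a * T + 2 * B * T)))
      \<le> \<sigma> * (running_max x T - g (drawdown T) - x 0)"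
    by linarith
  then show ?thesis
    unfolding C_def B_def[symmetric] by (simp add: algebra_simps)
qed

text \<open>Uniform continuity of \<open>x\<close> on the compact interval makes the oscillation
  small for fine grids. The tolerance \<open>\<epsilon>\<close> is shared equally by the terms of
  order \<open>e\<close>, the term of order \<open>\<delta>\<close> and the centred sum weighted by
  \<open>q\<close>.\<close>

lemma dyadic_grid_bound:
  assumes T: "0 < T" and \<epsilon>: "0 < \<epsilon>"
  defines "\<delta> \<equiv> \<lambda>j. T / 2 ^ j"
  defines "y \<equiv> \<lambda>j k. grid_max (\<lambda>i. x (real i * \<delta> j)) k - x (real k * \<delta> j)"
    and "dw \<equiv> \<lambda>j k. w (real (Suc k) * \<delta> j) - w (real k * \<delta> j)"
  assumes V: "(\<lambda>j. \<Sum>k<2^j. (dw j k)\<^sup>2 - \<delta> j) \<longlonglongrightarrow> 0"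
    and Vq: "(\<lambda>j. \<Sum>k<2^j. q (y j k) * ((dw j k)\<^sup>2 - \<delta> j)) \<longlonglongrightarrow> 0"
  shows "eventually (\<lambda>j. \<sigma> * l * T + \<sigma> * sqrt a * (\<Sum>k<2^j. p (y j k) * dw j k) - \<epsilon>
    \<le> \<sigma> * (running_max x T - g (drawdown T) - x 0)) sequentially"
proof -
  define K where "K = 1 + P + 2 * Q * (running_max x T - x 0) + \<Lambda> * (a + a * T + 2 * max b c * T)
          + (2 * Q * max b c + a * \<Lambda>) * T + Q * max b c * T"
  \<comment> \<open>Small enough for \<open>K * e \<le> \<epsilon> / 3\<close>, and at most 1 as
    \<open>grid_bound\<close> requires.\<close>
  define e where "e = min 1 (\<epsilon> / 3 / (\<bar>K\<bar> + 1))"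
  have e: "0 < e" "e \<le> 1" using \<epsilon> by (auto simp: e_def)
  have "K * e \<le> (\<bar>K\<bar> + 1) * (\<epsilon> / 3 / (\<bar>K\<bar> + 1))"
    using e by (intro mult_mono) (auto simp: e_def)
  also have "\<dots> = \<epsilon> / 3"
    using abs_ge_zero[of K] by (simp add: field_simps)
  finally have Ke: "K * e \<le> \<epsilon> / 3" .
  have "(\<lambda>j. T * (1 / 2) ^ j) \<longlonglongrightarrow> T * 0"
    by (intro tendsto_mult tendsto_const LIMSEQ_power_zero) auto
  then have \<delta>_lim: "\<delta> \<longlonglongrightarrow> 0" by (simp add: \<delta>_def power_divide)
  have "uniformly_continuous_on {0..T} x"
    by (intro compact_uniformly_continuous continuous_on_subset[OF x_cont]) auto
  then obtain d where d: "0 < d" "\<And>u v. u \<in> {0..T} \<Longrightarrow> v \<in> {0..T} \<Longrightarrow> dist v u < d \<Longrightarrow> dist (x v) (x u) < e"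
    unfolding uniformly_continuous_on_def using e(1) by metis
  have "eventually (\<lambda>j. \<delta> j < d) sequentially"
    using \<delta>_lim d(1) by (rule order_tendstoD)
  moreover have "eventually (\<lambda>j. Q * (max b c)\<^sup>2 * T / 2 * \<delta> j < \<epsilon> / 3) sequentially"
    by (rule order_tendstoD(2)[OF tendsto_mult_right_zero[OF \<delta>_lim]]) (use \<epsilon> in simp)
  moreover have "eventually (\<lambda>j. (\<Sum>k<2^j. (dw j k)\<^sup>2 - \<delta> j) < 1) sequentially"
    using V by (rule order_tendstoD) simp
  moreover have "eventually (\<lambda>j. a / 2 * \<bar>\<Sum>k<2^j. q (y j k) * ((dw j k)\<^sup>2 - \<delta> j)\<bar> < \<epsilon> / 3) sequentially"
    by (rule order_tendstoD(2)[OF tendsto_mult_right_zero[OF tendsto_rabs_zero[OF Vq]]]) (use \<epsilon> in simp)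
  ultimately show ?thesis
  proof eventually_elim
    case (elim j)
    have \<delta>: "0 < \<delta> j" "real (2 ^ j) * \<delta> j = T" using T by (auto simp: \<delta>_def)
    have osc: "\<bar>x v - x u\<bar> \<le> e" if "0 \<le> u" "u \<le> v" "v \<le> T" "v - u \<le> \<delta> j" for u v
      using d(2)[of u v] that elim(1) by (auto simp: dist_real_def)
    from grid_bound[OF \<delta> less_imp_le[OF e(1)] e(2) osc] elim Ke show ?case
      unfolding y_def dw_def K_def by linarith
  qed
qed

end

subsection \<open>Construction of the barrier\<close>

text \<open>In each of the four sign cases the deviation from the tangent is at most
  \<open>h\<^sup>2\<close>. Squared positive parts are the building blocks of the smoothing.\<close>

lemma DERIV_positive_part_square:
  "((\<lambda>x. (max 0 x)\<^sup>2) has_real_derivative 2 * max 0 x) (at x)"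
  unfolding DERIV_def
proof (rule LIM_zero_cancel, rule Lim_null_comparison)
  have "\<bar>(max 0 (x + h))\<^sup>2 - (max 0 x)\<^sup>2 - 2 * max 0 x * h\<bar> \<le> h\<^sup>2" for h :: real
  proof (cases "0 \<le> x"; cases "0 \<le> x + h")
    assume "0 \<le> x" "\<not> 0 \<le> x + h"
    then have "0 \<le> x * (- x - h)" by (auto intro: mult_nonneg_nonneg)
    moreover have "0 \<le> (x + h)\<^sup>2" by simp
    moreover have "max 0 (x + h) = 0" "max 0 x = x" using \<open>0 \<le> x\<close> \<open>\<not> 0 \<le> x + h\<close> by auto
    ultimately show ?thesis
      by (simp add: power2_eq_square algebra_simps abs_le_iff)
        (use zero_le_square[of x] zero_le_square[of h] in linarith)
  next
    assume "\<not> 0 \<le> x" "0 \<le> x + h"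
    then have "(x + h)\<^sup>2 \<le> h\<^sup>2" by (intro power_mono) auto
    with \<open>\<not> 0 \<le> x\<close> \<open>0 \<le> x + h\<close> show ?thesis by (simp add: max_def)
  qed (auto simp: max_def power2_eq_square algebra_simps)
  then have "norm (((max 0 (x + h))\<^sup>2 - (max 0 x)\<^sup>2) / h - 2 * max 0 x) \<le> \<bar>h\<bar>" if "h \<noteq> 0" for h
  proof -
    have "((max 0 (x + h))\<^sup>2 - (max 0 x)\<^sup>2) / h - 2 * max 0 x =
        ((max 0 (x + h))\<^sup>2 - (max 0 x)\<^sup>2 - 2 * max 0 x * h) / h"
      using that by (simp add: field_simps)
    also have "\<bar>\<dots>\<bar> \<le> h\<^sup>2 / \<bar>h\<bar>"
      unfolding abs_divide by (intro divide_right_mono) (fact, simp)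
    also have "\<dots> = \<bar>h\<bar>" using that by (simp add: power2_eq_square field_simps)
    finally show ?thesis by simp
  qed
  then show "eventually (\<lambda>h. norm (((max 0 (x + h))\<^sup>2 - (max 0 x)\<^sup>2) / h - 2 * max 0 x) \<le> \<bar>h\<bar>) (at 0)"
    by (auto simp: eventually_at_filter)
  show "((\<lambda>h::real. \<bar>h\<bar>) \<longlongrightarrow> 0) (at 0)"
    by (intro tendsto_rabs_zero tendsto_ident_at)
qed

text \<open>The function \<open>\<psi>\<close> is a \<open>C\<^sup>1\<close> smoothing of \<open>min y (\<alpha> + \<eta> / 2)\<close>.\<close>

locale smooth_cutoff =
  fixes \<alpha> \<eta> :: real
  assumes \<eta>_pos: "0 < \<eta>"
begin

text \<open>The linear ramp from 1 at \<open>\<alpha>\<close> to 0 at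
  \<open>\<alpha> + \<eta>\<close>, which is the derivative of \<open>\<psi>\<close>.\<close>

definition \<phi> :: "real \<Rightarrow> real" where
  "\<phi> y = 1 - (max 0 (y - \<alpha>) - max 0 (y - \<alpha> - \<eta>)) / \<eta>"

definition \<psi> :: "real \<Rightarrow> real" where
  "\<psi> y = y - ((max 0 (y - \<alpha>))\<^sup>2 - (max 0 (y - \<alpha> - \<eta>))\<^sup>2) / (2 * \<eta>)"

lemma \<psi>_deriv: "(\<psi> has_real_derivative \<phi> y) (at y)"
proof -
  have sq: "((\<lambda>y. (max 0 (y - r))\<^sup>2) has_real_derivative 2 * max 0 (y - r)) (at y)" for r :: real
  proof -
    have "((\<lambda>y. y - r) has_real_derivative 1) (at y)"
      by (auto intro!: derivative_eq_intros)
    from DERIV_chain2[OF DERIV_positive_part_square this] show ?thesis by simp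
  qed
  have "(\<psi> has_real_derivative 1 - (2 * max 0 (y - \<alpha>) - 2 * max 0 (y - (\<alpha> + \<eta>))) / (2 * \<eta>)) (at y)"
    unfolding \<psi>_def diff_diff_add
    by (intro DERIV_diff DERIV_ident DERIV_cdivide sq)
  moreover have "(2 * u - 2 * v) / (2 * \<eta>) = (u - v) / \<eta>" for u v
    using \<eta>_pos by (simp add: field_simps)
  ultimately show ?thesis
    by (simp only: \<phi>_def diff_diff_add)
qed

lemma \<phi>_bounds: "0 \<le> \<phi> y" "\<phi> y \<le> 1"
  using \<eta>_pos by (auto simp: \<phi>_def max_def field_simps)

lemma \<phi>_below: "y \<le> \<alpha> \<Longrightarrow> \<phi> y = 1"
  using \<eta>_pos by (simp add: \<phi>_def max_def)

lemma \<phi>_above: "\<alpha> + \<eta> \<le> y \<Longrightarrow> \<phi> y = 0"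
  using \<eta>_pos by (simp add: \<phi>_def max_def)

lemma \<phi>_lipschitz: "\<bar>\<phi> y - \<phi> z\<bar> \<le> 2 / \<eta> * \<bar>y - z\<bar>"
proof -
  have "\<phi> y - \<phi> z = ((max 0 (z - \<alpha>) - max 0 (y - \<alpha>)) - (max 0 (z - \<alpha> - \<eta>) - max 0 (y - \<alpha> - \<eta>))) / \<eta>"
    by (simp add: \<phi>_def diff_divide_distrib)
  then have "\<bar>\<phi> y - \<phi> z\<bar> = \<bar>(max 0 (z - \<alpha>) - max 0 (y - \<alpha>)) - (max 0 (z - \<alpha> - \<eta>) - max 0 (y - \<alpha> - \<eta>))\<bar> / \<eta>"
    using \<eta>_pos by simp
  also have "\<dots> \<le> 2 * \<bar>y - z\<bar> / \<eta>"
  proof (rule divide_right_mono)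
    have lip: "\<bar>max 0 u - max 0 v\<bar> \<le> \<bar>u - v\<bar>" for u v :: real
      by (simp add: max_def abs_if)
    show "\<bar>(max 0 (z - \<alpha>) - max 0 (y - \<alpha>)) - (max 0 (z - \<alpha> - \<eta>) - max 0 (y - \<alpha> - \<eta>))\<bar> \<le> 2 * \<bar>y - z\<bar>"
      using order_trans[OF abs_triangle_ineq4 add_mono[OF lip[of "z - \<alpha>" "y - \<alpha>"]
            lip[of "z - \<alpha> - \<eta>" "y - \<alpha> - \<eta>"]]]
      by (simp add: abs_minus_commute)
  qed (use \<eta>_pos in simp)
  finally show ?thesis by simp
qed

lemma \<psi>_below: "y \<le> \<alpha> \<Longrightarrow> \<psi> y = y"
  using \<eta>_pos by (simp add: \<psi>_def max_def)

lemma \<psi>_above: "\<alpha> + \<eta> \<le> y \<Longrightarrow> \<psi> y = \<alpha> + \<eta> / 2"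
  using \<eta>_pos by (simp add: \<psi>_def max_def power2_eq_square field_simps)

lemma \<psi>_middle: "\<alpha> \<le> y \<Longrightarrow> y \<le> \<alpha> + \<eta> \<Longrightarrow> \<psi> y = y - (y - \<alpha>)\<^sup>2 / (2 * \<eta>)"
  using \<eta>_pos by (cases "y = \<alpha>") (simp_all add: \<psi>_def max_def)

lemma \<psi>_le: "\<psi> y \<le> \<alpha> + \<eta> / 2"
proof -
  consider "y \<le> \<alpha>" | "\<alpha> + \<eta> \<le> y" | "\<alpha> \<le> y" "y \<le> \<alpha> + \<eta>" by linarith
  then show ?thesis
  proof cases
    case 3
    \<comment> \<open>Divided by \<open>2 * \<eta>\<close>, this square is the gap between
      \<open>\<psi> y\<close> and its maximal value.\<close>
    have "0 \<le> (y - \<alpha> - \<eta>)\<^sup>2" by simp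
    then show ?thesis using \<eta>_pos unfolding \<psi>_middle[OF 3] by (simp add: power2_eq_square field_simps)
  qed (use \<eta>_pos \<psi>_below \<psi>_above in auto)
qed

lemma \<psi>_ge: "\<alpha> \<le> y \<Longrightarrow> \<alpha> \<le> \<psi> y"
proof (cases "y \<le> \<alpha> + \<eta>")
  case True
  assume "\<alpha> \<le> y"
  with True have "0 \<le> (y - \<alpha>) * (2 * \<eta> - (y - \<alpha>))" using \<eta>_pos by (intro mult_nonneg_nonneg) auto
  then show ?thesis
    using \<eta>_pos unfolding \<psi>_middle[OF \<open>\<alpha> \<le> y\<close> True] by (simp add: power2_eq_square field_simps)
next
  case False
  then have "\<psi> y = \<alpha> + \<eta> / 2" by (intro \<psi>_above) simp
  then show ?thesis using \<eta>_pos by simp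
qed

text \<open>An upper bound on \<open>\<psi>\<close> bounds the exponential by \<open>G\<close> on
  the whole line, and the Lipschitz ramp makes \<open>q\<close> Lipschitz by the product rule for
  differences. Since \<open>\<alpha>\<close> is nonnegative, \<open>\<psi> 0 = 0\<close>, which
  gives \<open>p 0 = 1\<close>. The function \<open>g\<close> is an antiderivative of
  \<open>p\<close> shifted to vanish at 0.\<close>

lemma barrier_of_cutoff:
  fixes K \<kappa> p\<^sub>0 :: real
  assumes "0 \<le> \<alpha>" "0 < \<kappa>" "p\<^sub>0 + K = 1"
  defines "p \<equiv> \<lambda>y. p\<^sub>0 + K * exp (\<kappa> * \<psi> y)" and "q \<equiv> \<lambda>y. K * \<kappa> * exp (\<kappa> * \<psi> y) * \<phi> y"
  shows "\<exists>g P Q \<Lambda>. barrier g p q P Q \<Lambda>"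
proof -
  define G where "G = exp (\<kappa> * (\<alpha> + \<eta> / 2))"
  have G: "exp (\<kappa> * \<psi> y) \<le> G" "0 \<le> G" for y
    using \<psi>_le assms(2) by (auto simp: G_def)
  have p_deriv: "(p has_real_derivative q y) (at y)" for y
    unfolding p_def q_def by (auto intro!: derivative_eq_intros \<psi>_deriv)
  have exp_deriv: "((\<lambda>y. exp (\<kappa> * \<psi> y)) has_real_derivative \<kappa> * exp (\<kappa> * \<psi> y) * \<phi> y) (at y)" for y
    by (auto intro!: derivative_eq_intros \<psi>_deriv)
  have exp_bound: "\<bar>\<kappa> * exp (\<kappa> * \<psi> y) * \<phi> y\<bar> \<le> \<kappa> * G" for y
  proof -
    have "\<kappa> * exp (\<kappa> * \<psi> y) * \<phi> y \<le> \<kappa> * G * 1"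
      using G \<phi>_bounds assms(2) by (intro mult_mono) auto
    then show ?thesis using \<phi>_bounds assms(2) by (simp add: abs_mult)
  qed
  have exp_lip: "\<bar>exp (\<kappa> * \<psi> y) - exp (\<kappa> * \<psi> z)\<bar> \<le> \<kappa> * G * \<bar>y - z\<bar>" for y z
    using field_differentiable_bound[of UNIV "\<lambda>y. exp (\<kappa> * \<psi> y)"
        "\<lambda>y. \<kappa> * exp (\<kappa> * \<psi> y) * \<phi> y" "\<kappa> * G" y z] exp_deriv exp_bound
    by auto
  have "continuous_on UNIV p"
    using p_deriv by (auto intro!: continuous_at_imp_continuous_on DERIV_isCont)
  then have "\<exists>g. \<forall>y. - \<infinity> < ereal y \<longrightarrow> ereal y < \<infinity> \<longrightarrow> (g has_vector_derivative p y) (at y)"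
    by (intro einterval_antiderivative) (auto simp: continuous_on_eq_continuous_at)
  then obtain g\<^sub>0 where g\<^sub>0: "(g\<^sub>0 has_real_derivative p y) (at y)" for y
    by (auto simp: has_real_derivative_iff_has_vector_derivative)
  have "barrier (\<lambda>y. g\<^sub>0 y - g\<^sub>0 0) p q (\<bar>p\<^sub>0\<bar> + \<bar>K\<bar> * G) (\<bar>K\<bar> * (\<kappa> * G)) (\<bar>K\<bar> * \<kappa> * (\<kappa> * G + G * (2 / \<eta>)))"
  proof
    show "((\<lambda>y. g\<^sub>0 y - g\<^sub>0 0) has_real_derivative p y) (at y)" for y
      by (auto intro!: derivative_eq_intros g\<^sub>0)
    show "p 0 = 1" using assms(1,3) by (simp add: p_def \<psi>_below)
    show "\<bar>p y\<bar> \<le> \<bar>p\<^sub>0\<bar> + \<bar>K\<bar> * G" for y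
      unfolding p_def using G
      by (intro order_trans[OF abs_triangle_ineq] add_mono) (auto simp: abs_mult intro!: mult_left_mono)
    show "\<bar>q y\<bar> \<le> \<bar>K\<bar> * (\<kappa> * G)" for y
      using mult_left_mono[OF exp_bound, of "\<bar>K\<bar>" y] by (simp add: q_def abs_mult mult.assoc)
    show "\<bar>q y - q z\<bar> \<le> \<bar>K\<bar> * \<kappa> * (\<kappa> * G + G * (2 / \<eta>)) * \<bar>y - z\<bar>" for y z
    proof -
      let ?e = "\<lambda>y. exp (\<kappa> * \<psi> y)"
      have "\<bar>(?e y - ?e z) * \<phi> y\<bar> \<le> \<kappa> * G * \<bar>y - z\<bar> * 1"
        unfolding abs_mult using exp_lip \<phi>_bounds[of y] G(2) assms(2)
        by (intro mult_mono) auto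
      moreover have "\<bar>?e z * (\<phi> y - \<phi> z)\<bar> \<le> G * (2 / \<eta> * \<bar>y - z\<bar>)"
        unfolding abs_mult using G \<phi>_lipschitz by (intro mult_mono) auto
      moreover have "?e y * \<phi> y - ?e z * \<phi> z = (?e y - ?e z) * \<phi> y + ?e z * (\<phi> y - \<phi> z)"
        by (simp add: algebra_simps)
      ultimately have "\<bar>?e y * \<phi> y - ?e z * \<phi> z\<bar> \<le> (\<kappa> * G + G * (2 / \<eta>)) * \<bar>y - z\<bar>"
        by (simp add: distrib_right mult.assoc)
      then have "\<bar>K\<bar> * \<kappa> * \<bar>?e y * \<phi> y - ?e z * \<phi> z\<bar> \<le> \<bar>K\<bar> * \<kappa> * ((\<kappa> * G + G * (2 / \<eta>)) * \<bar>y - z\<bar>)"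
        using assms(2) by (intro mult_left_mono) auto
      moreover have "q y - q z = K * \<kappa> * (?e y * \<phi> y - ?e z * \<phi> z)"
        by (simp add: q_def algebra_simps)
      ultimately show ?thesis using assms(2) by (simp add: abs_mult mult.assoc)
    qed
  qed (use p_deriv in auto)
  then show ?thesis by blast
qed

end

text \<open>The smoothing is placed below or above \<open>\<gamma>\<close> according to the sign of the jump of \<open>p'\<close>, so that the
  error of order one that it causes near \<open>\<gamma>\<close> has the favourable sign.\<close>

lemma barrier_exists:
  fixes a b c \<gamma> v \<epsilon> \<sigma> :: real
  assumes pos: "0 < a" "0 < b" "0 < c" "0 < \<gamma>" and \<epsilon>: "0 < \<epsilon>"
    and v: "c * (v / b + (1 - v / b) * exp (2 * b / a * \<gamma>)) = v"
  obtains g p q P Q \<Lambda> where "barrier g p q P Q \<Lambda>"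
    and "\<And>y. \<sigma> * v - \<epsilon> \<le> \<sigma> * ((if y < \<gamma> then b else c) * p y - a / 2 * q y)"
proof -
  define \<kappa> K where "\<kappa> = 2 * b / a" and "K = 1 - v / b"
  have \<kappa>: "0 < \<kappa>" "a / 2 * \<kappa> = b" using pos by (auto simp: \<kappa>_def)
  \<comment> \<open>From \<open>\<gamma>\<close> on, \<open>\<psi>\<close> stays within
    \<open>\<eta> / 2\<close> of \<open>\<gamma>\<close>; continuity there keeps the signed error in
    \<open>c * p\<close> below \<open>\<epsilon>\<close>.\<close>
  have "isCont (\<lambda>z. \<sigma> * (c * (K * exp (\<kappa> * z)))) \<gamma>" by (intro continuous_intros)
  then obtain d where d: "0 < d"
    "\<And>z. \<bar>z - \<gamma>\<bar> < d \<Longrightarrow> \<bar>\<sigma> * (c * (K * exp (\<kappa> * z))) - \<sigma> * (c * (K * exp (\<kappa> * \<gamma>)))\<bar> < \<epsilon>"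
    using \<epsilon> unfolding continuous_at_eps_delta dist_real_def by blast
  define \<eta> where "\<eta> = min d \<gamma>"
  have \<eta>: "0 < \<eta>" "\<eta> \<le> d" "\<eta> \<le> \<gamma>" using d(1) pos by (auto simp: \<eta>_def)
  \<comment> \<open>The ramp ends at \<open>\<gamma>\<close> in the first case and starts there in
    the second; \<open>\<eta> \<le> \<gamma>\<close> keeps \<open>\<alpha>\<close>
    nonnegative.\<close>
  define \<alpha> where "\<alpha> = (if 0 \<le> \<sigma> * K then \<gamma> - \<eta> else \<gamma>)"
  interpret smooth_cutoff \<alpha> \<eta> by standard (rule \<eta>(1))
  define p where "p y = v / b + K * exp (\<kappa> * \<psi> y)" for y
  define q where "q y = K * \<kappa> * exp (\<kappa> * \<psi> y) * \<phi> y" for y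
  have "\<exists>g P Q \<Lambda>. barrier g p q P Q \<Lambda>"
    unfolding p_def q_def by (rule barrier_of_cutoff) (use \<eta> \<kappa> pos in \<open>auto simp: \<alpha>_def K_def\<close>)
  moreover have "\<sigma> * v - \<epsilon> \<le> \<sigma> * ((if y < \<gamma> then b else c) * p y - a / 2 * q y)" for y
  proof -
    let ?e = "exp (\<kappa> * \<psi> y)"
    have q: "a / 2 * q y = b * K * ?e * \<phi> y"
      unfolding q_def \<kappa>(2)[symmetric] by simp
    show ?thesis
    proof (cases "y < \<gamma>")
      case True
      \<comment> \<open>Below \<open>\<gamma>\<close> the defect in the equation comes from
        \<open>1 - \<phi> y\<close> alone. It has the sign of \<open>\<sigma> * K\<close>, or
        vanishes if the ramp has not yet started.\<close>
      have "0 \<le> \<sigma> * K * (b * ?e * (1 - \<phi> y))"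
      proof (cases "0 \<le> \<sigma> * K")
        case True
        then show ?thesis using pos \<phi>_bounds[of y] by simp
      next
        case False
        then show ?thesis using \<open>y < \<gamma>\<close> \<phi>_below[of y] by (simp add: \<alpha>_def)
      qed
      moreover have "\<sigma> * (b * p y - a / 2 * q y) = \<sigma> * v + \<sigma> * K * (b * ?e * (1 - \<phi> y))"
        unfolding q using pos by (simp add: p_def algebra_simps)
      ultimately show ?thesis using \<epsilon> unfolding if_P[OF True] by linarith
    next
      case False
      have "\<bar>\<psi> y - \<gamma>\<bar> < d"
      proof (cases "0 \<le> \<sigma> * K")
        case True
        then show ?thesis using \<psi>_above[of y] \<eta> False by (simp add: \<alpha>_def)
      next
        case neg: False
        then show ?thesis using \<psi>_ge[of y] \<psi>_le[of y] \<eta> False by (simp add: \<alpha>_def)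
      qed
      then have "- \<epsilon> \<le> \<sigma> * (c * (K * ?e)) - \<sigma> * (c * (K * exp (\<kappa> * \<gamma>)))"
        using d(2)[of "\<psi> y"] by linarith
      \<comment> \<open>From \<open>\<gamma>\<close> on the extra term is the remaining derivative
        \<open>q\<close>: zero if the ramp has ended, and of the favourable sign otherwise.\<close>
      moreover have "0 \<le> - (\<sigma> * K) * (b * ?e * \<phi> y)"
      proof (cases "0 \<le> \<sigma> * K")
        case True
        then show ?thesis using \<phi>_above[of y] False by (simp add: \<alpha>_def)
      next
        case neg: False
        then have "0 \<le> - (\<sigma> * K)" by simp
        moreover have "0 \<le> b * ?e * \<phi> y" using pos \<phi>_bounds[of y] by simp
        ultimately show ?thesis by (rule mult_nonneg_nonneg)
      qed
      \<comment> \<open>The equation assumed for \<open>v\<close> says that the unsmoothed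
        \<open>p\<close> equals \<open>v / c\<close> at \<open>\<gamma>\<close>.\<close>
      moreover have "c * p y = v + c * (K * ?e) - c * (K * exp (\<kappa> * \<gamma>))"
        using v by (simp add: p_def K_def \<kappa>_def algebra_simps)
      then have "\<sigma> * (c * p y - a / 2 * q y) = \<sigma> * v + (\<sigma> * (c * (K * ?e)) - \<sigma> * (c * (K * exp (\<kappa> * \<gamma>))))
          + - (\<sigma> * K) * (b * ?e * \<phi> y)"
        unfolding q \<open>c * p y = _\<close> by (simp add: algebra_simps)
      ultimately show ?thesis unfolding if_not_P[OF False] by linarith
    qed
  qed
  ultimately show ?thesis using that by blast
qed

subsection \<open>Law of large numbers\<close>

text \<open>The distance from \<open>t\<close> to the next skeleton time is at most
  \<open>2 * sqrt t + 1\<close>, so motion in that gap is negligible against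
  \<open>t\<close>.\<close>

lemma sublinear_remainder:
  fixes A e :: real
  assumes "0 < e"
  shows "eventually (\<lambda>t. A * (2 * sqrt t + 1) \<le> e * t) at_top"
proof -
  have "((\<lambda>t. inverse (sqrt t)) \<longlongrightarrow> 0) at_top" "((\<lambda>t::real. inverse t) \<longlongrightarrow> 0) at_top"
    by (intro tendsto_inverse_0_at_top sqrt_at_top filterlim_ident)+
  then have "((\<lambda>t. A * (2 * inverse (sqrt t) + inverse t)) \<longlongrightarrow> A * (2 * 0 + 0)) at_top"
    by (intro tendsto_intros)
  then have "eventually (\<lambda>t. A * (2 * inverse (sqrt t) + inverse t) < e) at_top"
    by (rule order_tendstoD) (use assms in simp)
  then show ?thesis
    using eventually_gt_at_top[of 0]
  proof eventually_elim
    case (elim t)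
    then have "A * (2 * inverse (sqrt t) + inverse t) * t \<le> e * t"
      by (intro mult_right_mono) auto
    moreover have "A * (2 * inverse (sqrt t) + inverse t) * t = A * (2 * (t / sqrt t) + t / t)"
      by (simp add: algebra_simps divide_inverse)
    moreover have "t / sqrt t = sqrt t" "t / t = 1"
      using elim(2) by (simp_all add: real_div_sqrt)
    ultimately show ?case by simp
  qed
qed

context drawdown_path
begin

text \<open>Late times \<open>s\<close> satisfy the bound with \<open>e * s \<le> e * t\<close>;
  early times form a compact set, on which the path is bounded by a constant that
  \<open>e * t\<close> eventually exceeds.\<close>

lemma uniformly_sublinear:
  assumes w_cont: "continuous_on {0..} w" and sub: "((\<lambda>t. (w t - w 0) / t) \<longlongrightarrow> 0) at_top" and e: "0 < e"
  shows "eventually (\<lambda>t. \<forall>s\<in>{0..t}. \<bar>w s - w 0\<bar> \<le> e * t) at_top"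
proof -
  have "eventually (\<lambda>t. \<bar>(w t - w 0) / t\<bar> < e) at_top"
    using tendsto_rabs_zero[OF sub] e by (rule order_tendstoD)
  then obtain t\<^sub>1 where t\<^sub>1: "\<bar>(w t - w 0) / t\<bar> < e" if "t\<^sub>1 \<le> t" for t
    unfolding eventually_at_top_linorder by auto
  have "bounded ((\<lambda>s. w s - w 0) ` {0..max 1 t\<^sub>1})"
    by (intro compact_imp_bounded compact_continuous_image continuous_intros continuous_on_subset[OF w_cont]) auto
  then obtain C where "\<forall>z\<in>(\<lambda>s. w s - w 0) ` {0..max 1 t\<^sub>1}. \<bar>z\<bar> \<le> C"
    unfolding bounded_iff real_norm_def by (rule exE)
  then have C: "\<bar>w s - w 0\<bar> \<le> C" if "s \<in> {0..max 1 t\<^sub>1}" for s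
    using that by (auto simp only: ball_simps)
  show ?thesis
    using eventually_ge_at_top[of "max 1 (C / e)"]
  proof eventually_elim
    case (elim t)
    show ?case
    proof
      fix s assume s: "s \<in> {0..t}"
      show "\<bar>w s - w 0\<bar> \<le> e * t"
      proof (cases "s \<le> max 1 t\<^sub>1")
        case True
        then have "\<bar>w s - w 0\<bar> \<le> C" using s by (intro C) auto
        also have "C \<le> e * t" using elim e by (simp add: pos_divide_le_eq mult.commute)
        finally show ?thesis .
      next
        case False
        then have "0 < s" by linarith
        moreover have "\<bar>(w s - w 0) / s\<bar> < e" using False by (intro t\<^sub>1) linarith
        ultimately have "\<bar>w s - w 0\<bar> \<le> e * s"
          by (simp add: abs_divide pos_divide_less_eq less_imp_le)
        also have "\<dots> \<le> e * t" using s e by (intro mult_left_mono) auto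
        finally show ?thesis .
      qed
    qed
  qed
qed

end

context drawdown_barrier
begin

text \<open>The times \<open>(m + 1)\<^sup>2\<close> are sparse enough for summability and dense enough for interpolation:
  the interval between two of them is of the order of the square root.\<close>

lemma speed_bound:
  assumes w_cont: "continuous_on {0..} w" and sub: "((\<lambda>t. (w t - w 0) / t) \<longlongrightarrow> 0) at_top"
    and sq: "\<And>e. 0 < e \<Longrightarrow> eventually (\<lambda>m. \<sigma> * l * (real m + 1)\<^sup>2
        - \<sigma> * (running_max x ((real m + 1)\<^sup>2) - g (drawdown ((real m + 1)\<^sup>2)) - x 0)
      \<le> e * (real m + 1)\<^sup>2) sequentially"
    and \<epsilon>: "0 < \<epsilon>"
  shows "eventually (\<lambda>t. (\<sigma> * l - \<epsilon>) * t \<le> \<sigma> * x t) at_top"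
proof -
  \<comment> \<open>Counts the errors of size \<open>e * S\<close> in order: the excess at the
    skeleton time, drawdown with \<open>g\<close>, starting value, Brownian displacement. With
    \<open>S \<le> 4 * t\<close> and one further \<open>e * t\<close> for the drift in the gap, the
    total is \<open>e * (1 + 4 * C) * t = \<epsilon> * t\<close>.\<close>
  define C where "C = 1 + (1 + P) + 1 + 2 * sqrt a"
  have C: "0 < C" using constants_nonneg a_pos by (simp add: C_def add_pos_nonneg)
  define e where "e = \<epsilon> / (1 + 4 * C)"
  have e: "0 < e" "e * (1 + 4 * C) = \<epsilon>" using C \<epsilon> by (auto simp: e_def)
  define T where "T t = (real (nat \<lfloor>sqrt t\<rfloor>) + 1)\<^sup>2" for t
  have T_top: "filterlim T at_top at_top"
  proof (rule filterlim_at_top_mono[OF filterlim_ident])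
    show "eventually (\<lambda>t. t \<le> T t) at_top"
      using eventually_ge_at_top[of 0] unfolding T_def by eventually_elim (rule nat_floor_sqrt(2))
  qed
  have ev_sq: "eventually (\<lambda>t. \<sigma> * l * T t - \<sigma> * (running_max x (T t) - g (drawdown (T t)) - x 0) \<le> e * T t) at_top"
    unfolding T_def
    by (rule eventually_compose_filterlim[OF sq[OF e(1)] filterlim_nat_floor_sqrt])
  \<comment> \<open>The first bound serves the Brownian displacement, the second the drawdown
    estimate with its factor \<open>2 * sqrt a\<close>.\<close>
  define \<eta> where "\<eta> = min e (e / (2 * sqrt a))"
  have \<eta>: "0 < \<eta>" "\<eta> \<le> e" "2 * sqrt a * \<eta> \<le> e"
  proof -
    show "0 < \<eta>" "\<eta> \<le> e" using e a_pos by (auto simp: \<eta>_def)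
    have "2 * sqrt a * \<eta> \<le> 2 * sqrt a * (e / (2 * sqrt a))"
      using a_pos by (intro mult_left_mono) (auto simp: \<eta>_def)
    then show "2 * sqrt a * \<eta> \<le> e" using a_pos by simp
  qed
  have ev_w: "eventually (\<lambda>t. \<forall>s\<in>{0..T t}. \<bar>w s - w 0\<bar> \<le> \<eta> * T t) at_top"
    by (rule eventually_compose_filterlim[OF uniformly_sublinear[OF w_cont sub \<eta>(1)] T_top])
  have ev_x0: "eventually (\<lambda>t. \<bar>x 0\<bar> \<le> e * t) at_top"
    using eventually_ge_at_top[of "\<bar>x 0\<bar> / e"] by eventually_elim (use e in \<open>simp add: field_simps\<close>)
  have ev_rem: "eventually (\<lambda>t. (max b c + \<bar>l\<bar>) * (2 * sqrt t + 1) \<le> e * t) at_top"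
    by (rule sublinear_remainder) (rule e)
  show ?thesis
    using ev_sq ev_w ev_x0 ev_rem eventually_ge_at_top[of 1]
  proof eventually_elim
    case (elim t)
    define m where "m = real (nat \<lfloor>sqrt t\<rfloor>)"
    define S where "S = T t"
    have S: "S = (m + 1)\<^sup>2" by (simp add: S_def T_def m_def)
    have t1: "1 \<le> t" by fact
    have mt: "m\<^sup>2 \<le> t" "t \<le> S" using nat_floor_sqrt[of t] t1 unfolding S m_def by auto
    have m_le: "m \<le> sqrt t" using t1 by (simp add: m_def)
    have "S - t \<le> 2 * m + 1" using mt(1) unfolding S by (simp add: power2_eq_square algebra_simps)
    then have gap: "S - t \<le> 2 * sqrt t + 1" using m_le by linarith
    have "1 \<le> m" using t1 unfolding m_def by (simp add: le_nat_iff le_floor_iff)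
    then have "0 \<le> (m - 1) * (3 * m + 1)" by (intro mult_nonneg_nonneg) auto
    then have S4: "S \<le> 4 * t" using mt(1) unfolding S by (simp add: power2_eq_square algebra_simps)
    have S0: "0 \<le> S" using mt t1 by linarith
    have "(max b c + \<bar>l\<bar>) * (S - t) \<le> (max b c + \<bar>l\<bar>) * (2 * sqrt t + 1)"
      using gap b_pos by (intro mult_left_mono) auto
    with elim(4) have rem: "max b c * (S - t) + \<bar>l\<bar> * (S - t) \<le> e * t"
      by (simp add: distrib_right)
    have "drawdown S \<le> sqrt a * (2 * (\<eta> * S))"
      using elim(2) S0 unfolding S_def[symmetric] by (intro drawdown_le) auto
    also have "\<dots> = 2 * sqrt a * \<eta> * S" by simp
    also have "\<dots> \<le> e * S" using \<eta> S0 by (intro mult_right_mono) auto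
    finally have dd: "drawdown S \<le> e * S" .
    have g: "\<bar>g (drawdown S)\<bar> \<le> P * (e * S)"
      using g_lipschitz[of "drawdown S" 0] g_0 drawdown_nonneg[OF S0] mult_left_mono[OF dd constants_nonneg(1)]
      by simp
    have x0: "\<bar>x 0\<bar> \<le> e * S" using elim(3) mult_left_mono[OF mt(2) less_imp_le[OF e(1)]] by linarith
    have w: "\<bar>w S - w t\<bar> \<le> 2 * (\<eta> * S)"
      using bspec[OF elim(2)[folded S_def], of S] bspec[OF elim(2)[folded S_def], of t] S0 mt t1 by auto
    then have "\<bar>sqrt a * (w S - w t)\<bar> \<le> sqrt a * (2 * (\<eta> * S))"
      unfolding abs_mult using a_pos by (intro mult_mono) auto
    also have "\<dots> \<le> sqrt a * (2 * (e * S))"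
      using a_pos \<eta> S0 by (intro mult_left_mono mult_right_mono) auto
    finally have w': "\<bar>sqrt a * (w S - w t)\<bar> \<le> 2 * sqrt a * (e * S)" by simp
    have "\<bar>x S - x t\<bar> \<le> 2 * sqrt a * (e * S) + max b c * (S - t)"
      using drift_increment_bounds[of t S] t1 mt w' by linarith
    then have "\<bar>\<sigma> * (x S - x t)\<bar> \<le> 2 * sqrt a * (e * S) + max b c * (S - t)" by (subst abs_\<sigma>)
    then have 1: "\<sigma> * x S - (2 * sqrt a * (e * S) + max b c * (S - t)) \<le> \<sigma> * x t"
      by (simp add: right_diff_distrib abs_le_iff)
    \<comment> \<open>Since \<open>x S\<close> is the running maximum minus the drawdown, this
      bounds what separates \<open>x S\<close> from the compensated quantity.\<close>
    have "\<bar>drawdown S - g (drawdown S) - x 0\<bar> \<le> (1 + P) * (e * S) + e * S"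
      using dd g x0 drawdown_nonneg[OF S0] unfolding distrib_right mult_1 by linarith
    then have "\<bar>\<sigma> * (drawdown S - g (drawdown S) - x 0)\<bar> \<le> (1 + P) * (e * S) + e * S" by (subst abs_\<sigma>)
    then have "\<sigma> * (running_max x S - g (drawdown S) - x 0) - ((1 + P) * (e * S) + e * S) \<le> \<sigma> * x S"
      by (simp add: right_diff_distrib abs_le_iff)
    with elim(1)[folded S_def] have 2: "\<sigma> * l * S - e * S - ((1 + P) * (e * S) + e * S) \<le> \<sigma> * x S"
      by linarith
    have "\<bar>\<sigma> * (l * (S - t))\<bar> \<le> \<bar>l\<bar> * (S - t)" using mt by (subst abs_\<sigma>) (simp add: abs_mult)
    then have 3: "\<sigma> * l * t - \<bar>l\<bar> * (S - t) \<le> \<sigma> * l * S" by (simp add: algebra_simps abs_le_iff)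
    have "C * (e * S) \<le> C * (e * (4 * t))" using C e S4 by (intro mult_left_mono) auto
    then have 4: "C * (e * S) + e * t \<le> \<epsilon> * t" unfolding e(2)[symmetric] by (simp add: algebra_simps)
    have "C * (e * S) = e * S + (1 + P) * (e * S) + e * S + 2 * sqrt a * (e * S)"
      by (simp add: C_def algebra_simps)
    with 1 2 3 4 rem have "\<sigma> * l * t - \<epsilon> * t \<le> \<sigma> * x t" by linarith
    then show ?case by (simp add: left_diff_distrib)
  qed
qed

end

section \<open>Second moment of the excess over a fixed time interval\<close>

context filtered_brownian_motion
begin

text \<open>Fatou's lemma replaces the passage to the limit in the stochastic integral.\<close>

lemma barrier_second_moment:
  fixes a b c \<gamma> x0 :: real and X :: "real \<Rightarrow> 'a \<Rightarrow> real"
  assumes "0 < a"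
    and X: "\<And>t. 0 \<le> t \<Longrightarrow> X t \<in> borel_measurable (F t)"
    and path: "AE \<omega> in M. drawdown_path a b c \<gamma> x0 (\<lambda>t. X t \<omega>) (\<lambda>t. W t \<omega>)"
    and barrier: "barrier g p q P Q \<Lambda>" and \<sigma>: "\<bar>\<sigma>\<bar> = 1"
    and super: "\<And>y. 0 \<le> y \<Longrightarrow> \<sigma> * l \<le> \<sigma> * ((if y < \<gamma> then b else c) * p y - a / 2 * q y)"
    and T: "0 < T"
  obtains Z where "Z \<in> borel_measurable M" "(\<integral>\<^sup>+\<omega>. Z \<omega> \<partial>M) \<le> ennreal (a * P\<^sup>2 * T)"
    and "AE \<omega> in M. ennreal ((max 0 (\<sigma> * l * T - \<sigma> * (running_max (\<lambda>t. X t \<omega>) T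
            - g (running_max (\<lambda>t. X t \<omega>) T - X T \<omega>) - X 0 \<omega>)))\<^sup>2) \<le> Z \<omega>"
proof -
  interpret barrier g p q P Q \<Lambda> by fact
  define \<delta> where "\<delta> j = T / 2 ^ j" for j :: nat
  define y where "y j k \<omega> = grid_max (\<lambda>i. X (real i * \<delta> j) \<omega>) k - X (real k * \<delta> j) \<omega>" for j k \<omega>
  define dw where "dw j k \<omega> = W (real (Suc k) * \<delta> j) \<omega> - W (real k * \<delta> j) \<omega>" for j k \<omega>
  have \<delta>: "0 < \<delta> j" "real (2 ^ j) * \<delta> j = T" for j using T by (auto simp: \<delta>_def)
  have y_F: "y j k \<in> borel_measurable (F (real k * \<delta> j))" for j k
    unfolding y_def
  proof (intro borel_measurable_diff grid_max_measurable)
    show "X (real i * \<delta> j) \<in> borel_measurable (F (real k * \<delta> j))" if "i \<le> k" for i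
      using that \<delta>(1)[of j] by (intro measurable_F_mono[OF X] mult_right_mono) auto
  qed (use X \<delta>(1)[of j] in auto)
  have p_meas: "p \<in> borel_measurable borel"
    by (intro borel_measurable_continuous_onI continuous_at_imp_continuous_on ballI DERIV_isCont[OF p_deriv])
  have "\<Lambda>-lipschitz_on UNIV q"
    using q_lipschitz constants_nonneg by (intro lipschitz_onI) (auto simp: dist_real_def)
  then have "continuous_on UNIV q" by (rule lipschitz_on_continuous_on)
  then have q_meas: "q \<in> borel_measurable borel" by (rule borel_measurable_continuous_onI)
  note moments = increment_moments[of "real k * \<delta> j" "real (Suc k) * \<delta> j" for k j]
  have step: "real k * \<delta> j < real (Suc k) * \<delta> j" "0 \<le> real k * \<delta> j"
    "real (Suc k) * \<delta> j - real k * \<delta> j = \<delta> j" for k j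
    using \<delta>(1)[of j] by (auto simp: algebra_simps)
  have transform: "integrable M (\<lambda>\<omega>. (\<Sum>k<2^j. H k \<omega> * \<phi> (dw j k \<omega>))\<^sup>2)"
    "expectation (\<lambda>\<omega>. (\<Sum>k<2^j. H k \<omega> * \<phi> (dw j k \<omega>))\<^sup>2) \<le> 2 ^ j * C\<^sup>2 * v"
    if "\<phi> \<in> borel_measurable borel" "\<And>k. H k \<in> borel_measurable (F (real k * \<delta> j))" "\<And>k \<omega>. \<bar>H k \<omega>\<bar> \<le> C"
      "\<And>k. integrable M (\<lambda>\<omega>. (\<phi> (dw j k \<omega>))\<^sup>2)" "\<And>k. expectation (\<lambda>\<omega>. \<phi> (dw j k \<omega>)) = 0"
      "\<And>k. expectation (\<lambda>\<omega>. (\<phi> (dw j k \<omega>))\<^sup>2) = v" for H C v j and \<phi> :: "real \<Rightarrow> real"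
    using transform_second_moment[of "\<lambda>k. real k * \<delta> j" \<phi> H C v "2 ^ j"] that step[of _ j]
    unfolding dw_def by auto
  define I where "I j \<omega> = (\<Sum>k<2^j. p (y j k \<omega>) * dw j k \<omega>)" for j \<omega>
  have I: "integrable M (\<lambda>\<omega>. (I j \<omega>)\<^sup>2)" "expectation (\<lambda>\<omega>. (I j \<omega>)\<^sup>2) \<le> P\<^sup>2 * T" for j
    using transform[of "\<lambda>x. x" "\<lambda>k \<omega>. p (y j k \<omega>)" j P "\<delta> j"] moments[OF step(2) step(1)]
      measurable_compose[OF y_F p_meas] p_bound \<delta>(2)[of j]
    unfolding I_def dw_def step(3) by (auto simp: mult.commute mult.left_commute)
  \<comment> \<open>Second moments of order \<open>2 ^ -j\<close> are summable, so convergence holds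
    almost surely along all dyadic grids. The instances are \<open>f = q\<close> and the constant
    1.\<close>
  have V: "AE \<omega> in M. (\<lambda>j. \<Sum>k<2^j. f (y j k \<omega>) * ((dw j k \<omega>)\<^sup>2 - \<delta> j)) \<longlonglongrightarrow> 0"
    if f: "f \<in> borel_measurable borel" "\<And>u. \<bar>f u\<bar> \<le> C" for f C
  proof -
    define V where "V j \<omega> = (\<Sum>k<2^j. f (y j k \<omega>) * ((dw j k \<omega>)\<^sup>2 - \<delta> j))" for j \<omega>
    have sq_int: "integrable M (\<lambda>\<omega>. ((dw j k \<omega>)\<^sup>2 - \<delta> j)\<^sup>2)" for j k
    proof -
      have eq: "((dw j k \<omega>)\<^sup>2 - \<delta> j)\<^sup>2 = dw j k \<omega> ^ 4 - 2 * \<delta> j * (dw j k \<omega>)\<^sup>2 + (\<delta> j)\<^sup>2" for \<omega>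
        by (simp add: power2_eq_square power4_eq_xxxx algebra_simps)
      show ?thesis
        unfolding eq using moments(1)[OF step(2) step(1), of k j] by (auto simp: dw_def)
    qed
    have exp0: "expectation (\<lambda>\<omega>. (dw j k \<omega>)\<^sup>2 - \<delta> j) = 0" for j k
      using moments(1)[OF step(2) step(1), of k j 2] moments(3)[OF step(2) step(1), of k j] step(3)[of k j]
      by (simp add: dw_def prob_space)
    have V: "integrable M (\<lambda>\<omega>. (V j \<omega>)\<^sup>2)" "expectation (\<lambda>\<omega>. (V j \<omega>)\<^sup>2) \<le> 2 * C\<^sup>2 * T\<^sup>2 * (1 / 2) ^ j" for j
    proof -
      have *: "2 ^ j * C\<^sup>2 * (2 * (\<delta> j)\<^sup>2) = 2 * C\<^sup>2 * T\<^sup>2 * (1 / 2) ^ j"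
        by (simp add: \<delta>_def power2_eq_square field_simps)
      have "expectation (\<lambda>\<omega>. ((dw j k \<omega>)\<^sup>2 - \<delta> j)\<^sup>2) = 2 * (\<delta> j)\<^sup>2" for k
        using moments(4)[OF step(2) step(1), of k j] unfolding step(3) dw_def .
      then show "integrable M (\<lambda>\<omega>. (V j \<omega>)\<^sup>2)" "expectation (\<lambda>\<omega>. (V j \<omega>)\<^sup>2) \<le> 2 * C\<^sup>2 * T\<^sup>2 * (1 / 2) ^ j"
        unfolding V_def *[symmetric]
        by (intro transform[of "\<lambda>x. x\<^sup>2 - \<delta> j" "\<lambda>k \<omega>. f (y j k \<omega>)" j C "2 * (\<delta> j)\<^sup>2"]
            measurable_compose[OF y_F f(1)] f(2) sq_int exp0; simp)+
    qed
    have "AE \<omega> in M. (\<lambda>j. ennreal ((V j \<omega>)\<^sup>2)) \<longlonglongrightarrow> 0"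
    proof (rule AE_tendsto_zero_of_summable)
      show "(\<lambda>\<omega>. ennreal ((V j \<omega>)\<^sup>2)) \<in> borel_measurable M" for j
        using V(1)[of j] by measurable
      show "(\<integral>\<^sup>+\<omega>. ennreal ((V j \<omega>)\<^sup>2) \<partial>M) \<le> ennreal (2 * C\<^sup>2 * T\<^sup>2 * (1 / 2) ^ j)" for j
        by (subst nn_integral_eq_integral) (auto intro!: V ennreal_leI)
      show "summable (\<lambda>j. 2 * C\<^sup>2 * T\<^sup>2 * (1 / 2 :: real) ^ j)"
        by (intro summable_mult summable_geometric) simp
    qed auto
    then show ?thesis
    proof eventually_elim
      case (elim \<omega>)
      then have "(\<lambda>j. (V j \<omega>)\<^sup>2) \<longlonglongrightarrow> 0"
        by (subst (asm) tendsto_ennreal_iff[of _ _ 0, unfolded ennreal_0]) auto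
      then show ?case unfolding V_def by (simp add: power_tendsto_0_iff)
    qed
  qed
  show ?thesis
  proof
    show "(\<lambda>\<omega>. liminf (\<lambda>j. ennreal (a * (I j \<omega>)\<^sup>2))) \<in> borel_measurable M"
      using I(1) by measurable
    show "(\<integral>\<^sup>+\<omega>. liminf (\<lambda>j. ennreal (a * (I j \<omega>)\<^sup>2)) \<partial>M) \<le> ennreal (a * P\<^sup>2 * T)"
    proof (rule nn_integral_liminf_le)
      show "(\<lambda>\<omega>. ennreal (a * (I j \<omega>)\<^sup>2)) \<in> borel_measurable M" for j
        using I(1)[of j] by measurable
      show "(\<integral>\<^sup>+\<omega>. ennreal (a * (I j \<omega>)\<^sup>2) \<partial>M) \<le> ennreal (a * P\<^sup>2 * T)" for j
        using I[of j] assms(1)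
        by (subst nn_integral_eq_integral) (auto intro!: ennreal_leI simp: mult.assoc)
    qed
    have "AE \<omega> in M. (\<lambda>j. \<Sum>k<2^j. (dw j k \<omega>)\<^sup>2 - \<delta> j) \<longlonglongrightarrow> 0"
      using V[of "\<lambda>_. 1" 1] by simp
    with path V[of q Q, OF q_meas q_bound]
    show "AE \<omega> in M. ennreal ((max 0 (\<sigma> * l * T - \<sigma> * (running_max (\<lambda>t. X t \<omega>) T
            - g (running_max (\<lambda>t. X t \<omega>) T - X T \<omega>) - X 0 \<omega>)))\<^sup>2) \<le> liminf (\<lambda>j. ennreal (a * (I j \<omega>)\<^sup>2))"
    proof eventually_elim
      case (elim \<omega>)
      interpret drawdown_path a b c \<gamma> x0 "\<lambda>t. X t \<omega>" "\<lambda>t. W t \<omega>" by fact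
      interpret drawdown_barrier a b c \<gamma> x0 "\<lambda>t. X t \<omega>" "\<lambda>t. W t \<omega>" g p q P Q \<Lambda> \<sigma> l
        by standard (fact \<sigma>, fact super)
      define D where "D = \<sigma> * l * T - \<sigma> * (running_max (\<lambda>t. X t \<omega>) T
            - g (running_max (\<lambda>t. X t \<omega>) T - X T \<omega>) - X 0 \<omega>)"
      \<comment> \<open>The loss \<open>e\<close> of \<open>dyadic_grid_bound\<close> is removed by
        letting \<open>e\<close> decrease to 0 on the left; the right-hand side does not depend on
        it.\<close>
      have "ennreal ((max 0 D)\<^sup>2) \<le> liminf (\<lambda>j. ennreal (a * (I j \<omega>)\<^sup>2))"
      proof (rule tendsto_upperbound)
        show "((\<lambda>e. ennreal ((max 0 (D - e))\<^sup>2)) \<longlongrightarrow> ennreal ((max 0 D)\<^sup>2)) (at_right 0)"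
          by (intro tendsto_ennrealI tendsto_power tendsto_max tendsto_const)
            (auto intro!: tendsto_eq_intros)
        show "eventually (\<lambda>e. ennreal ((max 0 (D - e))\<^sup>2) \<le> liminf (\<lambda>j. ennreal (a * (I j \<omega>)\<^sup>2))) (at_right 0)"
          using eventually_at_right_less[of 0]
        proof eventually_elim
          case (elim e)
          have "eventually (\<lambda>j. \<sigma> * l * T + \<sigma> * sqrt a * I j \<omega> - e
              \<le> \<sigma> * (running_max (\<lambda>t. X t \<omega>) T - g (running_max (\<lambda>t. X t \<omega>) T - X T \<omega>) - X 0 \<omega>)) sequentially"
            using dyadic_grid_bound[OF T elim] \<open>(\<lambda>j. \<Sum>k<2^j. q (y j k \<omega>) * ((dw j k \<omega>)\<^sup>2 - \<delta> j)) \<longlonglongrightarrow> 0\<close>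
              \<open>(\<lambda>j. \<Sum>k<2^j. (dw j k \<omega>)\<^sup>2 - \<delta> j) \<longlonglongrightarrow> 0\<close>
            unfolding I_def y_def dw_def \<delta>_def by blast
          then have "eventually (\<lambda>j. ennreal ((max 0 (D - e))\<^sup>2) \<le> ennreal (a * (I j \<omega>)\<^sup>2)) sequentially"
          proof eventually_elim
            case (elim j)
            \<comment> \<open>A positive excess \<open>D - e\<close> is at most minus the signed
              transform, so it is bounded by the absolute value of the transform whatever
              \<open>\<sigma>\<close> is.\<close>
            have "\<bar>\<sigma> * (sqrt a * I j \<omega>)\<bar> = \<bar>sqrt a * I j \<omega>\<bar>" by (rule abs_\<sigma>)
            with elim have "\<bar>max 0 (D - e)\<bar> \<le> \<bar>sqrt a * I j \<omega>\<bar>"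
              unfolding D_def mult.assoc by linarith
            then have "(max 0 (D - e))\<^sup>2 \<le> (sqrt a * I j \<omega>)\<^sup>2"
              by (simp only: abs_le_square_iff)
            then show ?case using a_pos by (intro ennreal_leI) (simp add: power_mult_distrib)
          qed
          then show ?case by (rule Liminf_bounded)
        qed
      qed simp
      then show ?case unfolding D_def .
    qed
  qed
qed

end

section \<open>Almost sure one-sided bounds\<close>

context filtered_brownian_motion
begin

text \<open>The positive excess at time \<open>T m\<close> has second moment of order
  \<open>T m\<close>, so its square divided by \<open>(T m)\<^sup>2\<close> has summable mean and
  the excess is \<open>o(T m)\<close> almost surely. Half of \<open>\<epsilon>\<close> pays for the
  barrier, half for \<open>speed_bound\<close>.\<close>

lemma one_sided_speed:
  fixes a b c \<gamma> x0 v \<sigma> \<epsilon> :: real and X :: "real \<Rightarrow> 'a \<Rightarrow> real"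
  assumes pos: "0 < a" "0 < b" "0 < c" "0 < \<gamma>"
    and v: "c * (v / b + (1 - v / b) * exp (2 * b / a * \<gamma>)) = v"
    and X: "\<And>t. 0 \<le> t \<Longrightarrow> X t \<in> borel_measurable (F t)"
    and path: "AE \<omega> in M. drawdown_path a b c \<gamma> x0 (\<lambda>t. X t \<omega>) (\<lambda>t. W t \<omega>)"
    and \<sigma>: "\<bar>\<sigma>\<bar> = 1" and \<epsilon>: "0 < \<epsilon>"
  shows "AE \<omega> in M. eventually (\<lambda>t. (\<sigma> * v - \<epsilon>) * t \<le> \<sigma> * X t \<omega>) at_top"
proof -
  obtain g p q P Q \<Lambda> where bar: "barrier g p q P Q \<Lambda>"
    and super: "\<And>y. \<sigma> * v - \<epsilon> / 2 \<le> \<sigma> * ((if y < \<gamma> then b else c) * p y - a / 2 * q y)"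
    using barrier_exists[OF pos half_gt_zero[OF \<epsilon>] v] by metis
  \<comment> \<open>Shifted against the direction of the bound: as \<open>\<sigma>\<close> squares
    to 1, \<open>\<sigma> * l = \<sigma> * v - \<epsilon> / 2\<close>.\<close>
  define l where "l = v - \<sigma> * (\<epsilon> / 2)"
  have "\<sigma> * \<sigma> = 1" using \<sigma> by (metis abs_mult_self_eq mult_1)
  then have l: "\<sigma> * l = \<sigma> * v - \<epsilon> / 2" by (simp add: l_def right_diff_distrib flip: mult.assoc)
  define T where "T m = (real m + 1)\<^sup>2" for m :: nat
  have T: "0 < T m" for m by (simp add: T_def)
  define D where "D m \<omega> = \<sigma> * l * T m - \<sigma> * (running_max (\<lambda>t. X t \<omega>) (T m)
      - g (running_max (\<lambda>t. X t \<omega>) (T m) - X (T m) \<omega>) - X 0 \<omega>)" for m \<omega>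
  have "\<forall>m. \<exists>Z. Z \<in> borel_measurable M \<and> (\<integral>\<^sup>+\<omega>. Z \<omega> \<partial>M) \<le> ennreal (a * P\<^sup>2 * T m) \<and>
      (AE \<omega> in M. ennreal ((max 0 (D m \<omega>))\<^sup>2) \<le> Z \<omega>)"
  proof
    fix m
    have super': "\<sigma> * l \<le> \<sigma> * ((if y < \<gamma> then b else c) * p y - a / 2 * q y)" for y
      using super l by simp
    obtain Z where "Z \<in> borel_measurable M" "(\<integral>\<^sup>+\<omega>. Z \<omega> \<partial>M) \<le> ennreal (a * P\<^sup>2 * T m)"
      "AE \<omega> in M. ennreal ((max 0 (D m \<omega>))\<^sup>2) \<le> Z \<omega>"
      unfolding D_def by (rule barrier_second_moment[OF pos(1) X path bar \<sigma> super' T[of m]])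
    then show "\<exists>Z. Z \<in> borel_measurable M \<and> (\<integral>\<^sup>+\<omega>. Z \<omega> \<partial>M) \<le> ennreal (a * P\<^sup>2 * T m) \<and>
      (AE \<omega> in M. ennreal ((max 0 (D m \<omega>))\<^sup>2) \<le> Z \<omega>)"
      by blast
  qed
  from choice[OF this] obtain Z where Z [measurable]: "\<And>m. Z m \<in> borel_measurable M"
    and Z_int: "\<And>m. (\<integral>\<^sup>+\<omega>. Z m \<omega> \<partial>M) \<le> ennreal (a * P\<^sup>2 * T m)"
    and Z_ge: "\<And>m. AE \<omega> in M. ennreal ((max 0 (D m \<omega>))\<^sup>2) \<le> Z m \<omega>"
    by blast
  have "AE \<omega> in M. (\<lambda>m. ennreal (1 / (T m)\<^sup>2) * Z m \<omega>) \<longlonglongrightarrow> 0"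
  proof (rule AE_tendsto_zero_of_summable)
    show "(\<integral>\<^sup>+\<omega>. ennreal (1 / (T m)\<^sup>2) * Z m \<omega> \<partial>M) \<le> ennreal (a * P\<^sup>2 * (1 / (real (Suc m))\<^sup>2))" for m
    proof -
      have "(\<integral>\<^sup>+\<omega>. ennreal (1 / (T m)\<^sup>2) * Z m \<omega> \<partial>M) \<le> ennreal (1 / (T m)\<^sup>2) * ennreal (a * P\<^sup>2 * T m)"
        by (subst nn_integral_cmult) (auto intro!: mult_left_mono Z_int)
      also have "\<dots> = ennreal (a * P\<^sup>2 * (1 / T m))"
        using T[of m] pos by (simp flip: ennreal_mult add: power2_eq_square)
      finally show ?thesis by (simp add: T_def add.commute)
    qed
    show "summable (\<lambda>m. a * P\<^sup>2 * (1 / (real (Suc m))\<^sup>2))"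
      using inverse_power_summable[of 2, where ?'a = real]
      by (intro summable_mult) (subst summable_Suc_iff, simp add: inverse_eq_divide)
  qed (use pos in auto)
  moreover have "AE \<omega> in M. \<forall>m. ennreal ((max 0 (D m \<omega>))\<^sup>2) \<le> Z m \<omega>"
    using Z_ge by (simp add: AE_all_countable)
  moreover have "AE \<omega> in M. continuous_on {0..} (\<lambda>t. W t \<omega>)"
    using brownian by (simp add: brownian_motion_def)
  ultimately show ?thesis
    using path brownian_sublinear
  proof eventually_elim
    case (elim \<omega>)
    interpret drawdown_path a b c \<gamma> x0 "\<lambda>t. X t \<omega>" "\<lambda>t. W t \<omega>" by fact
    interpret barrier g p q P Q \<Lambda> by fact
    interpret drawdown_barrier a b c \<gamma> x0 "\<lambda>t. X t \<omega>" "\<lambda>t. W t \<omega>" g p q P Q \<Lambda> \<sigma> l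
      by standard (use \<sigma> l super in auto)
    have "eventually (\<lambda>t. (\<sigma> * l - \<epsilon> / 2) * t \<le> \<sigma> * X t \<omega>) at_top"
    proof (rule speed_bound)
      fix e :: real assume e: "0 < e"
      have "eventually (\<lambda>m. ennreal (1 / (T m)\<^sup>2) * Z m \<omega> < ennreal (e\<^sup>2)) sequentially"
        using elim(1) e by (intro order_tendstoD) auto
      then have "eventually (\<lambda>m. D m \<omega> \<le> e * T m) sequentially"
      proof eventually_elim
        case (elim m)
        have "ennreal (1 / (T m)\<^sup>2 * (max 0 (D m \<omega>))\<^sup>2) = ennreal (1 / (T m)\<^sup>2) * ennreal ((max 0 (D m \<omega>))\<^sup>2)"
          by (intro ennreal_mult) auto
        also have "\<dots> \<le> ennreal (1 / (T m)\<^sup>2) * Z m \<omega>"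
          using \<open>\<forall>m. ennreal ((max 0 (D m \<omega>))\<^sup>2) \<le> Z m \<omega>\<close> by (intro mult_left_mono) auto
        also have "\<dots> < ennreal (e\<^sup>2)" by fact
        finally have "(max 0 (D m \<omega>) / T m)\<^sup>2 < e\<^sup>2"
          by (simp add: ennreal_less_iff power_divide)
        then have "max 0 (D m \<omega>) / T m < e" by (rule power_less_imp_less_base) (use e in simp)
        then show ?case using T[of m] by (simp add: pos_divide_less_eq)
      qed
      then show "eventually (\<lambda>m. \<sigma> * l * (real m + 1)\<^sup>2
          - \<sigma> * (running_max (\<lambda>t. X t \<omega>) ((real m + 1)\<^sup>2)
            - g (running_max (\<lambda>t. X t \<omega>) ((real m + 1)\<^sup>2) - X ((real m + 1)\<^sup>2) \<omega>) - X 0 \<omega>)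
        \<le> e * (real m + 1)\<^sup>2) sequentially"
        unfolding D_def T_def .
    qed (use elim \<epsilon> in simp_all)
    then show ?case by (simp add: l)
  qed
qed

end

section \<open>Identification of the speed and passage to the limit\<close>

theorem theorem5:
  fixes M :: "'a measure" and F :: "real \<Rightarrow> 'a measure"
    and W X :: "real \<Rightarrow> 'a \<Rightarrow> real" and a b c \<gamma> x0 :: real
  assumes "a > 0" and "b > 0" and "c > 0" and "\<gamma> > 0"
    and "filtered_prob_space M F"
    and "brownian_motion M F W"
    and "diffusion_solution M F W a (drawdown_drift b c \<gamma>) x0 X"
  shows "AE \<omega> in M.
    ((\<lambda>t. X t \<omega> / t) \<longlongrightarrow>
      (c * (exp (2 * b * \<gamma> / a) - 1) /
       (c * (exp (2 * b * \<gamma> / a) - 1) + (b - c) * (1 - exp (- (2 * b * \<gamma> / a))))) * b) at_top"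
proof -
  interpret filtered_brownian_motion M F W by standard fact+
  define E where "E = exp (2 * b * \<gamma> / a)"
  define v where "v = c * (E - 1) / (c * (E - 1) + (b - c) * (1 - exp (- (2 * b * \<gamma> / a)))) * b"
  have E: "1 < E" using assms by (simp add: E_def)
  \<comment> \<open>Grouped this way, positivity of the denominator is clear also when
    \<open>c > b\<close>.\<close>
  have "0 < b + c * (E - 1)" using E assms by (intro add_pos_nonneg) auto
  then have den: "0 < b - c + c * E" by (simp add: algebra_simps)
  have "exp (- (2 * b * \<gamma> / a)) = 1 / E"
    by (simp add: E_def exp_minus inverse_eq_divide)
  \<comment> \<open>Extracting \<open>(E - 1) / E\<close> reduces the claimed speed to
    \<open>b * c * E / (b - c + c * E)\<close>, the solution of the linear equation that the barrier
    imposes on \<open>v\<close>.\<close>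
  moreover have "c * (E - 1) + (b - c) * (1 - 1 / E) = (E - 1) / E * (b - c + c * E)"
    using E by (simp add: field_simps)
  ultimately have "v = c * (E - 1) / ((E - 1) / E * (b - c + c * E)) * b"
    by (simp only: v_def)
  also have "\<dots> = b * c * E / (b - c + c * E)"
    using E by simp
  finally have v_eq: "v = b * c * E / (b - c + c * E)" .
  have "c * (v / b + (1 - v / b) * exp (2 * b / a * \<gamma>)) = v"
  proof -
    have "v * (b - c + c * E) = b * c * E" using den by (simp add: v_eq)
    then have "c * (v / b + (1 - v / b) * E) = v" using assms(2) by (simp add: field_simps)
    then show ?thesis by (simp add: E_def)
  qed
  moreover have "X t \<in> borel_measurable (F t)" if "0 \<le> t" for t
    using assms(7) that by (simp add: diffusion_solution_def adapted_process_def)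
  moreover have "AE \<omega> in M. drawdown_path a b c \<gamma> x0 (\<lambda>t. X t \<omega>) (\<lambda>t. W t \<omega>)"
  proof -
    have "AE \<omega> in M. continuous_on {0..} (\<lambda>t. X t \<omega>)"
      "AE \<omega> in M. \<forall>t\<ge>0. set_integrable lborel {0..t} (\<lambda>s. drawdown_drift b c \<gamma> s (\<lambda>u. X u \<omega>)) \<and>
        X t \<omega> = x0 + sqrt a * W t \<omega> + (LINT s:{0..t}|lborel. drawdown_drift b c \<gamma> s (\<lambda>u. X u \<omega>))"
      using assms(7) by (auto simp: diffusion_solution_def)
    then show ?thesis
      by eventually_elim (use assms(1-4) in \<open>auto intro: drawdown_path.intro\<close>)
  qed
  ultimately have bound: "AE \<omega> in M. eventually (\<lambda>t. (\<sigma> * v - \<epsilon>) * t \<le> \<sigma> * X t \<omega>) at_top"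
    if "\<bar>\<sigma>\<bar> = 1" "0 < \<epsilon>" for \<sigma> \<epsilon>
    using one_sided_speed[OF assms(1-4) _ _ _ that] by blast
  \<comment> \<open>A countable sequence of tolerances keeps the exceptional set null; the signs 1
    and -1 give the lower and the upper bound.\<close>
  have "AE \<omega> in M. \<forall>n. eventually (\<lambda>t. (1 * v - inverse (real (Suc n))) * t \<le> 1 * X t \<omega>) at_top"
    "AE \<omega> in M. \<forall>n. eventually (\<lambda>t. ((-1) * v - inverse (real (Suc n))) * t \<le> (-1) * X t \<omega>) at_top"
    unfolding AE_all_countable by (intro allI bound; simp)+
  then have "AE \<omega> in M. ((\<lambda>t. X t \<omega> / t) \<longlongrightarrow> v) at_top"
  proof eventually_elim
    case (elim \<omega>)
    show ?case
    proof (rule tendstoI)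
      fix e :: real assume "0 < e"
      then obtain n where n: "inverse (real (Suc n)) < e" using reals_Archimedean by blast
      from elim(1)[rule_format, of n] elim(2)[rule_format, of n] eventually_gt_at_top[of 0]
      show "eventually (\<lambda>t. dist (X t \<omega> / t) v < e) at_top"
      proof eventually_elim
        case (elim t)
        have "(v - inverse (real (Suc n))) * t \<le> X t \<omega>" "X t \<omega> \<le> (v + inverse (real (Suc n))) * t"
          using elim(1,2) by (simp_all add: algebra_simps)
        then have "v - inverse (real (Suc n)) \<le> X t \<omega> / t" "X t \<omega> / t \<le> v + inverse (real (Suc n))"
          by (simp_all only: pos_le_divide_eq[OF elim(3)] pos_divide_le_eq[OF elim(3)])
        with n show ?case unfolding dist_real_def by linarith
      qed
    qed
  qed
  then show ?thesis unfolding v_def E_def .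
qed

end
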